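(* For every positive integer $N$ there exists a family of row-computable $2$-sparse Hamiltonians $H$, all acting on a common finite-dimensional space, such that simulating the evolution of $H$ (given as a black box, for an unknown member $H$ of the family) for scaled time $\tau=\|H\|t=\pi N/2$ within precision $1/4$ requires at least $\tau/2\pi$ queries to $H$. That is, any quantum query algorithm which, for every $H$ in the family, when given black-box access to $H$, approximates $e^{-iHt}$ with $t=\pi N/(2\|H\|)$ with trace-distance error at most $1/4$ on every initial state, must use at least $\tau/(2\pi)=N/4$ queries to $H$.
   Context: A Hamiltonian (Hermitian matrix) is $2$-sparse if it has at most two nonzero entries in each row/column. It is row-computable if there is a method for efficiently calculating the nonzero elements in each row. $\|\cdot\|$ is the operator norm, and trace distance is $D(\rho,\sigma)=\frac12\mathrm{Tr}|\rho-\sigma|$. A query to $H$ is one application of the standard reversible oracle (or its inverse) which, on input a column index $x$, returns the positions and values of the nonzero entries in column $x$ of $H$. A quantum query algorithm is a quantum circuit (with ancillas) interleaving queries with unitaries that do not depend on which member $H$ of the family is given. *)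

theory Defs
  imports
    Complex_Main
    "HOL-Library.Log_Nat"
    "Jordan_Normal_Form.Schur_Decomposition"
begin

definition hermitian_mat :: "complex mat \<Rightarrow> bool" where
  "hermitian_mat A \<longleftrightarrow> square_mat A \<and> mat_adjoint A = A"

definition unitary_mat :: "complex mat \<Rightarrow> bool" where
  "unitary_mat U \<longleftrightarrow> square_mat U \<and>
     U * mat_adjoint U = 1\<^sub>m (dim_row U) \<and> mat_adjoint U * U = 1\<^sub>m (dim_row U)"

definition psd_mat :: "complex mat \<Rightarrow> bool" where
  "psd_mat A \<longleftrightarrow> hermitian_mat A \<and>
     (\<forall>v \<in> carrier_vec (dim_row A). 0 \<le> Re ((A *\<^sub>v v) \<bullet>c v))"

definition mat_trace :: "complex mat \<Rightarrow> complex" where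
  "mat_trace A = (\<Sum>i<dim_row A. A $$ (i, i))"

definition euclidean_norm :: "complex vec \<Rightarrow> real" where
  "euclidean_norm v = sqrt (Re (v \<bullet>c v))"

definition operator_norm :: "complex mat \<Rightarrow> real" where
  "operator_norm A =
     (SUP v \<in> {v \<in> carrier_vec (dim_col A). euclidean_norm v = 1}. euclidean_norm (A *\<^sub>v v))"

definition mat_abs :: "complex mat \<Rightarrow> complex mat" where
  "mat_abs A = (THE B. B \<in> carrier_mat (dim_col A) (dim_col A) \<and> psd_mat B \<and>
     B * B = mat_adjoint A * A)"

definition trace_distance :: "complex mat \<Rightarrow> complex mat \<Rightarrow> real" where
  "trace_distance \<rho> \<sigma> = Re (mat_trace (mat_abs (\<rho> - \<sigma>))) / 2"

definition density_operator :: "nat \<Rightarrow> complex mat \<Rightarrow> bool" where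
  "density_operator d \<rho> \<longleftrightarrow> \<rho> \<in> carrier_mat d d \<and> psd_mat \<rho> \<and> mat_trace \<rho> = 1"

definition mat_exp :: "complex mat \<Rightarrow> complex mat" where
  "mat_exp A = mat (dim_row A) (dim_row A) (\<lambda>(i, j). \<Sum>k. (A ^\<^sub>m k) $$ (i, j) / fact k)"

definition evolution :: "complex mat \<Rightarrow> real \<Rightarrow> complex mat" where
  "evolution H t = mat_exp ((- \<i> * complex_of_real t) \<cdot>\<^sub>m H)"

definition kronecker :: "complex mat \<Rightarrow> complex mat \<Rightarrow> complex mat"  (infixr \<open>\<otimes>\<^sub>K\<close> 70) where
  "A \<otimes>\<^sub>K B = mat (dim_row A * dim_row B) (dim_col A * dim_col B)
     (\<lambda>(i, j). A $$ (i div dim_row B, j div dim_col B) * B $$ (i mod dim_row B, j mod dim_col B))"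

text \<open>\<open>partial_trace d a\<close> traces out the second factor of a \<open>d * a\<close>-dimensional tensor product.\<close>

definition partial_trace :: "nat \<Rightarrow> nat \<Rightarrow> complex mat \<Rightarrow> complex mat" where
  "partial_trace d a \<rho> = mat d d (\<lambda>(i, j). \<Sum>k<a. \<rho> $$ (i * a + k, j * a + k))"

definition zero_state :: "nat \<Rightarrow> complex mat" where
  "zero_state a = mat a a (\<lambda>(i, j). if i = 0 \<and> j = 0 then 1 else 0)"

definition hamiltonian :: "nat \<Rightarrow> complex mat \<Rightarrow> bool" where
  "hamiltonian d H \<longleftrightarrow> H \<in> carrier_mat d d \<and> hermitian_mat H"

definition sparse_mat :: "nat \<Rightarrow> complex mat \<Rightarrow> bool" where
  "sparse_mat s A \<longleftrightarrow>
     (\<forall>i<dim_row A. card {j. j < dim_col A \<and> A $$ (i, j) \<noteq> 0} \<le> s) \<and>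
     (\<forall>j<dim_col A. card {i. i < dim_row A \<and> A $$ (i, j) \<noteq> 0} \<le> s)"

text \<open>
  Efficiency is measured on while programs over integer registers, where every step is charged
  the bit length of its operands (logarithmic cost). Besides its registers, a program can read
  single bits of a word \<open>w\<close> which specifies the member of the family under consideration.
  The tests of \<open>If\<close> and \<open>While\<close> ask whether a register is positive.
\<close>

datatype arith = Plus | Minus | Times | Divide

datatype prog =
    Skip
  | Load nat int
  | Calc nat nat arith nat
  | ReadBit nat nat
  | Seq prog prog
  | If nat prog prog
  | While nat prog

type_synonym store = "nat \<Rightarrow> int"

fun arith_op :: "arith \<Rightarrow> int \<Rightarrow> int \<Rightarrow> int" where
  "arith_op Plus a b = a + b"
| "arith_op Minus a b = a - b"
| "arith_op Times a b = a * b"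
| "arith_op Divide a b = a div b"

definition bit_length :: "int \<Rightarrow> nat" where
  "bit_length v = floorlog 2 (nat \<bar>v\<bar>)"

definition word_bit :: "bool list \<Rightarrow> int \<Rightarrow> int" where
  "word_bit w v = (if 0 \<le> v \<and> v < int (length w) \<and> w ! nat v then 1 else 0)"

text \<open>\<open>run w P s T s'\<close>: started in \<open>s\<close> with word \<open>w\<close>, \<open>P\<close> halts in \<open>s'\<close> at total cost \<open>T\<close>.\<close>

inductive run :: "bool list \<Rightarrow> prog \<Rightarrow> store \<Rightarrow> nat \<Rightarrow> store \<Rightarrow> bool" for w where
  run_Skip: "run w Skip s 1 s"
| run_Load: "run w (Load r v) s (1 + bit_length v) (s(r := v))"
| run_Calc: "run w (Calc r a f b) s (1 + bit_length (s a) + bit_length (s b))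
               (s(r := arith_op f (s a) (s b)))"
| run_ReadBit: "run w (ReadBit r a) s (1 + bit_length (s a)) (s(r := word_bit w (s a)))"
| run_Seq: "run w P s T s' \<Longrightarrow> run w Q s' T' s'' \<Longrightarrow> run w (Seq P Q) s (T + T') s''"
| run_If_pos: "s r > 0 \<Longrightarrow> run w P s T s' \<Longrightarrow> run w (If r P Q) s (1 + T) s'"
| run_If_nonpos: "s r \<le> 0 \<Longrightarrow> run w Q s T s' \<Longrightarrow> run w (If r P Q) s (1 + T) s'"
| run_While_pos: "s r > 0 \<Longrightarrow> run w P s T s' \<Longrightarrow> run w (While r P) s' T' s'' \<Longrightarrow>
                    run w (While r P) s (1 + T + T') s''"
| run_While_nonpos: "s r \<le> 0 \<Longrightarrow> run w (While r P) s 1 s"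

text \<open>
  The input is the dimension \<open>d\<close>, the row index \<open>x\<close> and a precision \<open>p\<close>, in registers 0, 1, 2.
  On output, register 0 contains the number of nonzero entries of row \<open>x\<close>, and the \<open>k\<close>-th of them
  is described by the three registers from \<open>3 * k + 1\<close> on: its exact position, and the real and
  imaginary part of its value as multiples of \<open>1 / 2 ^ p\<close>.
\<close>

definition row_input :: "nat \<Rightarrow> nat \<Rightarrow> nat \<Rightarrow> store" where
  "row_input d x p = (\<lambda>_. 0)(0 := int d, 1 := int x, 2 := int p)"

definition row_output :: "complex mat \<Rightarrow> nat \<Rightarrow> nat \<Rightarrow> store \<Rightarrow> bool" where
  "row_output H x p s \<longleftrightarrow>
     0 \<le> s 0 \<and>
     bij_betw (\<lambda>k. s (3 * k + 1)) {..<nat (s 0)}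
       (int ` {y. y < dim_col H \<and> H $$ (x, y) \<noteq> 0}) \<and>
     (\<forall>k<nat (s 0).
        cmod (H $$ (x, nat (s (3 * k + 1)))
              - Complex (real_of_int (s (3 * k + 2)) / 2 ^ p) (real_of_int (s (3 * k + 3)) / 2 ^ p))
        \<le> 1 / 2 ^ p)"

text \<open>
  The running time is polynomial in the bit length of the dimension and in \<open>p\<close>. For a single
  matrix this would say little: \<open>P\<close> and \<open>c\<close> have to be fixed uniformly for all
  members of all families under consideration.
\<close>

definition row_computes :: "prog \<Rightarrow> nat \<Rightarrow> bool list \<Rightarrow> complex mat \<Rightarrow> bool" where
  "row_computes P c w H \<longleftrightarrow>
     (\<forall>x<dim_row H. \<forall>p. \<exists>T s.
        run w P (row_input (dim_row H) x p) T s \<and>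
        T \<le> (floorlog 2 (dim_row H) + p + 1) ^ c \<and>
        row_output H x p s)"

definition column_data :: "complex mat \<Rightarrow> nat \<Rightarrow> (nat \<times> complex) list" where
  "column_data H x = map (\<lambda>y. (y, H $$ (y, x))) (filter (\<lambda>y. H $$ (y, x) \<noteq> 0) [0..<dim_row H])"

text \<open>
  The answer register has \<open>r\<close> qubits. The encoding of column data (positions and exact values) as
  \<open>r\<close>-bit words is a convention common to the whole family, hence independent of the member.
\<close>

definition valid_encoding ::
  "nat \<Rightarrow> complex mat set \<Rightarrow> nat \<Rightarrow> ((nat \<times> complex) list \<Rightarrow> nat) \<Rightarrow> bool" where
  "valid_encoding d F r enc \<longleftrightarrow>
     (let D = {column_data H x | H x. H \<in> F \<and> x < d}
      in inj_on enc D \<and> enc ` D \<subseteq> {..<2 ^ r})"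

text \<open>\<open>|x\<rangle>|z\<rangle> \<mapsto> |x\<rangle>|z XOR f(x)\<rangle>\<close>, with \<open>f(x)\<close> the encoded column \<open>x\<close> of \<open>H\<close>.\<close>

definition query_oracle :: "nat \<Rightarrow> ((nat \<times> complex) list \<Rightarrow> nat) \<Rightarrow> complex mat \<Rightarrow> complex mat" where
  "query_oracle r enc H = mat (dim_row H * 2 ^ r) (dim_row H * 2 ^ r)
     (\<lambda>(i, j). if i div 2 ^ r = j div 2 ^ r \<and>
                  i mod 2 ^ r = Bit_Operations.xor (j mod 2 ^ r) (enc (column_data H (j div 2 ^ r)))
               then 1 else 0)"

datatype gate = Gate "complex mat" | Query | InverseQuery

text \<open>
  The registers are: the system (dimension \<open>d\<close>), carrying the state to be evolved, and as ancillas
  the query index (dimension \<open>d\<close>), the answer (\<open>r\<close> qubits) and a workspace (dimension \<open>W\<close>).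
\<close>

definition ancilla_dim :: "nat \<Rightarrow> nat \<Rightarrow> nat \<Rightarrow> nat" where
  "ancilla_dim d r W = d * 2 ^ r * W"

fun gate_mat ::
  "nat \<Rightarrow> ((nat \<times> complex) list \<Rightarrow> nat) \<Rightarrow> nat \<Rightarrow> complex mat \<Rightarrow> gate \<Rightarrow> complex mat" where
  "gate_mat r enc W H (Gate U) = U"
| "gate_mat r enc W H Query = 1\<^sub>m (dim_row H) \<otimes>\<^sub>K query_oracle r enc H \<otimes>\<^sub>K 1\<^sub>m W"
| "gate_mat r enc W H InverseQuery =
     1\<^sub>m (dim_row H) \<otimes>\<^sub>K mat_adjoint (query_oracle r enc H) \<otimes>\<^sub>K 1\<^sub>m W"

fun circuit_mat ::
  "nat \<Rightarrow> ((nat \<times> complex) list \<Rightarrow> nat) \<Rightarrow> nat \<Rightarrow> complex mat \<Rightarrow> gate list \<Rightarrow> complex mat" where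
  "circuit_mat r enc W H [] = 1\<^sub>m (dim_row H * ancilla_dim (dim_row H) r W)"
| "circuit_mat r enc W H (g # gs) = circuit_mat r enc W H gs * gate_mat r enc W H g"

definition valid_circuit :: "nat \<Rightarrow> nat \<Rightarrow> nat \<Rightarrow> gate list \<Rightarrow> bool" where
  "valid_circuit d r W gs \<longleftrightarrow> 0 < W \<and>
     (\<forall>U. Gate U \<in> set gs \<longrightarrow> dim_row U = d * ancilla_dim d r W \<and> unitary_mat U)"

definition query_count :: "gate list \<Rightarrow> nat" where
  "query_count gs = length (filter (\<lambda>g. g = Query \<or> g = InverseQuery) gs)"

definition circuit_output ::
  "nat \<Rightarrow> ((nat \<times> complex) list \<Rightarrow> nat) \<Rightarrow> nat \<Rightarrow> complex mat \<Rightarrow> gate list \<Rightarrow> complex mat \<Rightarrow> complex mat"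
where
  "circuit_output r enc W H gs \<rho> =
     (let a = ancilla_dim (dim_row H) r W; C = circuit_mat r enc W H gs
      in partial_trace (dim_row H) a (C * (\<rho> \<otimes>\<^sub>K zero_state a) * mat_adjoint C))"

definition simulates ::
  "nat \<Rightarrow> ((nat \<times> complex) list \<Rightarrow> nat) \<Rightarrow> nat \<Rightarrow> gate list \<Rightarrow> complex mat \<Rightarrow> real \<Rightarrow> real \<Rightarrow> bool" where
  "simulates r enc W gs H t \<epsilon> \<longleftrightarrow>
     (\<forall>\<rho>. density_operator (dim_row H) \<rho> \<longrightarrow>
        trace_distance (circuit_output r enc W H gs \<rho>)
          (evolution H t * \<rho> * mat_adjoint (evolution H t)) \<le> \<epsilon>)"

end

theory Submission
  imports Defs "Jordan_Normal_Form.Spectral_Radius" "HOL-Analysis.L2_Norm"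
begin

text \<open>
  The Hamiltonian is a ladder with sites \<open>(i, j)\<close>, \<open>0 \<le> i \<le> N\<close>, \<open>j \<in> {0, 1}\<close>, stored at index
  \<open>2 * i + j\<close>. Site \<open>(i, j)\<close> is joined to \<open>(i + 1, j XOR w ! i)\<close> with weight
  \<open>sqrt ((i + 1) * (N - i)) / 2\<close>, so that the ladder splits into two copies of the spin operator
  \<open>J\<^sub>x\<close> of spin \<open>N / 2\<close>. Hence its norm is \<open>N / 2\<close>, and time \<open>\<pi>\<close> carries \<open>(0, 0)\<close> to
  \<open>(N, parity of w)\<close> up to a phase: a simulation with error \<open>1 / 4\<close> computes the parity of \<open>w\<close> with
  bias. Each query reveals one column, which depends on at most two bits of \<open>w\<close>; the amplitudes of a
  circuit with \<open>q\<close> queries are therefore polynomials of degree \<open>2 * q\<close> in the bits of \<open>w\<close>, its output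
  probabilities have degree \<open>4 * q\<close>, and parity is orthogonal to all polynomials of degree below \<open>N\<close>.

  The entries are computed to precision \<open>2\<close> to the \<open>-p\<close> by an integer square root, found by bisection.
\<close>

section \<open>Spectral theory of Hermitian matrices\<close>

text \<open>The weights come from perfect state transfer: they make the spectrum equispaced,
  \<open>N / 2 - m\<close> for \<open>m \<le> N\<close>, so time \<open>pi\<close> multiplies the
  m-th mode by \<open>(- 1) ^ m\<close> up to a common phase. The two end states have the same
  expansion in the modes except for exactly this sign; that is the binomial theorem for
  \<open>(1 + z) + (1 - z)\<close> and \<open>(1 + z) - (1 - z)\<close>. The constant in the bound
  is 4 = 2 * 2: a column touches two bits, and probabilities are quadratic in amplitudes. As the
  norm is \<open>N / 2\<close>, scaled time \<open>pi * N / 2\<close> is time \<open>pi\<close>, and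
  \<open>N \<le> 4 * q\<close> is the claimed bound on the number \<open>q\<close> of queries.
  \<open>mat_abs\<close> is a definite description, so nothing can be said about trace distance
  before positive semidefinite square roots are known to be unique; this is what the spectral
  theorem is for. The time bound in \<open>row_computes\<close> is a pure power without a constant
  factor. All constants have to be absorbed into the exponent, which explains its size, 300.\<close>

lemma mat_adjoint_dim [simp]:
  "dim_row (mat_adjoint A) = dim_col A" "dim_col (mat_adjoint A) = dim_row A"
  by (simp_all add: mat_adjoint_def)

lemma mat_adjoint_index [simp]:
  assumes "i < dim_col A" "j < dim_row A"
  shows "mat_adjoint A $$ (i, j) = conjugate (A $$ (j, i))"
  using assms by (simp add: mat_adjoint_def mat_of_rows_index)

lemma mat_adjoint_carrier [simp]: "A \<in> carrier_mat n m \<Longrightarrow> mat_adjoint A \<in> carrier_mat m n"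
  by auto

lemma mat_adjoint_adjoint [simp]: "mat_adjoint (mat_adjoint A) = A"
  by (rule eq_matI) auto

lemma mat_adjoint_mult:
  fixes A B :: "complex mat"
  assumes "dim_col A = dim_row B"
  shows "mat_adjoint (A * B) = mat_adjoint B * mat_adjoint A"
  using assms
  by (intro eq_matI) (auto simp: scalar_prod_def intro!: sum.cong)

lemma mat_adjoint_one [simp]: "mat_adjoint (1\<^sub>m n :: complex mat) = 1\<^sub>m n"
  by (rule eq_matI) auto

lemma mat_adjoint_minus:
  fixes A B :: "complex mat"
  assumes "A \<in> carrier_mat n m" "B \<in> carrier_mat n m"
  shows "mat_adjoint (A - B) = mat_adjoint A - mat_adjoint B"
  using assms by (intro eq_matI) auto

text \<open>Its carrier premises mention dimensions that do not occur in the product. The variant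
  below has dimension equations as premises, which simplification can settle, and is applied only on
  request.\<close>

declare assoc_mult_mat [simp del]

lemma mat_mult_assoc:
  fixes A B C :: "'a::semiring_0 mat"
  assumes "dim_col A = dim_row B" "dim_col B = dim_row C"
  shows "(A * B) * C = A * (B * C)"
  using assms by (intro assoc_mult_mat) auto

lemma mat_diag_dims [simp]: "dim_row (mat_diag n f) = n" "dim_col (mat_diag n f) = n"
  by (simp_all add: mat_diag_def)

lemma mat_adjoint_four_block:
  fixes A B C D :: "complex mat"
  assumes "A \<in> carrier_mat n m" "B \<in> carrier_mat n k" "C \<in> carrier_mat l m" "D \<in> carrier_mat l k"
  shows "mat_adjoint (four_block_mat A B C D) =
    four_block_mat (mat_adjoint A) (mat_adjoint C) (mat_adjoint B) (mat_adjoint D)"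
  using assms by (intro eq_matI) (auto simp: four_block_mat_def Let_def)

lemma mat_mult_index_sum:
  "i < dim_row A \<Longrightarrow> j < dim_col B \<Longrightarrow> dim_col A = dim_row B \<Longrightarrow>
    (A * B) $$ (i, j) = (\<Sum>k<dim_row B. A $$ (i, k) * B $$ (k, j))"
  by (auto simp: scalar_prod_def atLeast0LessThan intro!: sum.cong)

lemma mat_adjoint_mat_diag:
  "mat_adjoint (mat_diag n f) = mat_diag n (\<lambda>i. cnj (f i))"
  by (rule eq_matI) (auto simp: mat_diag_def)

lemma mat_diag_eqD:
  "mat_diag n f = mat_diag n g \<Longrightarrow> i < n \<Longrightarrow> f i = g i"
  by (drule arg_cong[where f = "\<lambda>A. A $$ (i, i)"]) (simp add: mat_diag_def)

text \<open>Prepares deflation, where an eigenvector has to become a column of a unitary matrix.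
  Gram-Schmidt on a basis starting with \<open>v\<close> keeps \<open>v\<close> in front but gives
  columns that are merely orthogonal. They are rescaled afterwards, so \<open>v\<close> survives
  only up to the factor \<open>c\<close>.\<close>

lemma unitary_first_column:
  fixes v :: "complex vec"
  assumes v: "v \<in> carrier_vec n" "v \<noteq> 0\<^sub>v n"
  shows "\<exists>U c. U \<in> carrier_mat n n \<and> mat_adjoint U * U = 1\<^sub>m n \<and> col U 0 = c \<cdot>\<^sub>v v"
proof -
  have n: "0 < n" using v by (cases n) auto
  interpret cof_vec_space n "TYPE(complex)" .
  define b where "b = basis_completion v"
  define ws where "ws = gram_schmidt n b"
  define W where "W = mat_of_cols n ws"
  from basis_completion[OF v, folded b_def]
  have b: "distinct b" "\<not> lin_dep (set b)" "set b \<subseteq> carrier_vec n" "hd b = v" "length b = n"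
    by auto
  obtain vs where bv: "b = v # vs" using b n by (cases b) auto
  from gram_schmidt_result[OF b(3,1,2) refl, folded ws_def]
  have ws: "set ws \<subseteq> carrier_vec n" "corthogonal ws" "length ws = n"
    by (auto simp: b)
  have hd: "hd ws = v" using gram_schmidt_hd[OF v(1), of vs] unfolding ws_def bv .
  have W: "W \<in> carrier_mat n n" using ws mat_of_cols_carrier(1)[of n ws] by (simp add: W_def)
  have W0: "col W 0 = v"
    using ws hd n unfolding W_def by (subst col_mat_of_cols) (auto simp: hd_conv_nth subset_iff)
  have orth: "corthogonal_mat W" using orthogonal_mat_of_cols ws unfolding W_def .
  define g where "g j = euclidean_norm (col W j)" for j
  have gpos: "g j \<noteq> 0" and gsq: "col W j \<bullet>c col W j = complex_of_real (g j * g j)" if "j < n" for j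
  proof -
    have nz: "col W j \<bullet>c col W j \<noteq> 0" using corthogonal_matD[OF orth] that W by auto
    have re: "col W j \<bullet>c col W j = complex_of_real (\<Sum>i<n. (cmod (W $$ (i, j)))\<^sup>2)"
      using W that by (auto simp: scalar_prod_def complex_norm_square[symmetric] complex_mult_cnj atLeast0LessThan intro!: sum.cong)
    have "0 \<le> (\<Sum>i<n. (cmod (W $$ (i, j)))\<^sup>2)" by (intro sum_nonneg) auto
    then show "col W j \<bullet>c col W j = complex_of_real (g j * g j)"
      unfolding g_def euclidean_norm_def re by simp
    with nz show "g j \<noteq> 0" by auto
  qed
  define U where "U = mat n n (\<lambda>(i, j). W $$ (i, j) / g j)"
  have U: "U \<in> carrier_mat n n" by (simp add: U_def)
  have "mat_adjoint U * U = 1\<^sub>m n"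
  proof (rule eq_matI)
    fix i j assume "i < dim_row (1\<^sub>m n :: complex mat)" "j < dim_col (1\<^sub>m n :: complex mat)"
    then have ij: "i < n" "j < n" by auto
    have "(mat_adjoint U * U) $$ (i, j) = (\<Sum>k<n. cnj (W $$ (k, i) / g i) * (W $$ (k, j) / g j))"
      using ij by (subst mat_mult_index_sum) (auto simp: U_def)
    also have "\<dots> = (\<Sum>k<n. W $$ (k, j) * cnj (W $$ (k, i))) / (g i * g j)"
      unfolding sum_divide_distrib by (intro sum.cong) (auto simp: field_simps)
    also have "(\<Sum>k<n. W $$ (k, j) * cnj (W $$ (k, i))) = col W j \<bullet>c col W i"
      using W ij by (auto simp: scalar_prod_def atLeast0LessThan intro!: sum.cong)
    also have "\<dots> / (g i * g j) = (1\<^sub>m n) $$ (i, j)"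
    proof (cases "i = j")
      case True
      then show ?thesis using gsq[of i] gpos[of i] ij by simp
    next
      case False
      then show ?thesis using corthogonal_matD[OF orth, of j i] W ij by simp
    qed
    finally show "(mat_adjoint U * U) $$ (i, j) = 1\<^sub>m n $$ (i, j)" .
  qed (use U in auto)
  moreover have "col U 0 = (1 / complex_of_real (g 0)) \<cdot>\<^sub>v v"
  proof (rule eq_vecI)
    fix i assume "i < dim_vec ((1 / complex_of_real (g 0)) \<cdot>\<^sub>v v)"
    then have "i < n" using v by auto
    then show "col U 0 $ i = ((1 / complex_of_real (g 0)) \<cdot>\<^sub>v v) $ i"
      using v W n arg_cong[OF W0, of "\<lambda>v. v $ i"] by (simp add: U_def)
  qed (use U v in auto)
  ultimately show ?thesis using U by blast
qed

text \<open>Deflation. With an eigenvector as first column of \<open>W\<close>, the first column of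
  \<open>mat_adjoint W * A * W\<close> is \<open>e\<close> times a unit vector. Hermiticity then
  clears the first row too, and the remaining block is again Hermitian.\<close>

lemma hermitian_diagonalisation:
  fixes A :: "complex mat"
  assumes "A \<in> carrier_mat n n" "mat_adjoint A = A"
  shows "\<exists>U f. U \<in> carrier_mat n n \<and> mat_adjoint U * U = 1\<^sub>m n \<and>
    mat_adjoint U * A * U = mat_diag n f"
  using assms
proof (induction n arbitrary: A)
  case 0
  then show ?case by (intro exI[of _ "1\<^sub>m 0"] exI[of _ "\<lambda>_. 0"]) (auto simp: mat_diag_def)
next
  case (Suc m)
  let ?n = "Suc m"
  note A = Suc.prems(1)
  obtain e where "e \<in> spectrum A" using spectrum_non_empty[OF A] by auto
  then obtain v where v: "v \<in> carrier_vec ?n" "v \<noteq> 0\<^sub>v ?n" "A *\<^sub>v v = e \<cdot>\<^sub>v v"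
    using A unfolding spectrum_def eigenvalue_def eigenvector_def by auto
  obtain W c where W: "W \<in> carrier_mat ?n ?n" "mat_adjoint W * W = 1\<^sub>m ?n" "col W 0 = c \<cdot>\<^sub>v v"
    using unitary_first_column[OF v(1,2)] by blast
  define A' where "A' = mat_adjoint W * A * W"
  have A': "A' \<in> carrier_mat ?n ?n" using W(1) A by (auto simp: A'_def)
  have herm: "mat_adjoint A' = A'"
    unfolding A'_def using W(1) A Suc.prems(2)
    by (auto simp: mat_adjoint_mult mat_mult_assoc)
  have col0: "A' $$ (i, 0) = (if i = 0 then e else 0)" if "i < ?n" for i
  proof -
    have "A' = mat_adjoint W * (A * W)" unfolding A'_def using W(1) A by (auto simp: mat_mult_assoc)
    then have "A' $$ (i, 0) = row (mat_adjoint W) i \<bullet> col (A * W) 0" using that W A by simp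
    also have "col (A * W) 0 = A *\<^sub>v col W 0" using W A by (subst col_mult2[of _ ?n ?n _ ?n]) auto
    also have "\<dots> = e \<cdot>\<^sub>v col W 0"
      unfolding W(3) using A v by (simp add: mult_mat_vec smult_smult_assoc mult.commute)
    also have "row (mat_adjoint W) i \<bullet> (e \<cdot>\<^sub>v col W 0) = e * (mat_adjoint W * W) $$ (i, 0)"
      using W(1) that by simp
    also have "\<dots> = (if i = 0 then e else 0)" unfolding W(2) using that by simp
    finally show ?thesis .
  qed
  have row0: "A' $$ (0, j) = (if j = 0 then e else 0)" if "j < ?n" for j
  proof (cases "j = 0")
    case False
    have "A' $$ (0, j) = mat_adjoint A' $$ (0, j)" by (simp add: herm)
    also have "\<dots> = 0" using A' that False col0[OF that] by simp
    finally show ?thesis using False by simp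
  qed (use col0 in auto)
  define A3 where "A3 = mat m m (\<lambda>(i, j). A' $$ (Suc i, Suc j))"
  have A3: "A3 \<in> carrier_mat m m" by (simp add: A3_def)
  have herm3: "mat_adjoint A3 = A3"
  proof (rule eq_matI)
    fix i j assume "i < dim_row A3" "j < dim_col A3"
    then have ij: "i < m" "j < m" by (auto simp: A3_def)
    then have "A' $$ (Suc i, Suc j) = mat_adjoint A' $$ (Suc i, Suc j)" by (simp add: herm)
    then show "mat_adjoint A3 $$ (i, j) = A3 $$ (i, j)" using ij A' by (simp add: A3_def)
  qed (auto simp: A3_def)
  obtain U3 f where U3: "U3 \<in> carrier_mat m m" "mat_adjoint U3 * U3 = 1\<^sub>m m"
    "mat_adjoint U3 * A3 * U3 = mat_diag m f"
    using Suc.IH[OF A3 herm3] by blast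
  define E where "E = mat 1 1 (\<lambda>_. e)"
  have E: "E \<in> carrier_mat 1 1" by (simp add: E_def)
  have blk: "A' = four_block_mat E (0\<^sub>m 1 m) (0\<^sub>m m 1) A3"
  proof (rule eq_matI)
    fix i j
    assume "i < dim_row (four_block_mat E (0\<^sub>m 1 m) (0\<^sub>m m 1) A3)"
      "j < dim_col (four_block_mat E (0\<^sub>m 1 m) (0\<^sub>m m 1) A3)"
    then have "i < ?n" "j < ?n" by (auto simp: A3_def E_def)
    then show "A' $$ (i, j) = four_block_mat E (0\<^sub>m 1 m) (0\<^sub>m m 1) A3 $$ (i, j)"
      using col0[of i] row0[of j] by (cases i; cases j) (auto simp: A3_def E_def)
  qed (use A' in \<open>auto simp: A3_def E_def\<close>)
  \<comment> \<open>The unitary of the smaller block, extended by 1 so that it leaves the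
    eigenvector alone.\<close>
  define F where "F = four_block_mat (1\<^sub>m 1) (0\<^sub>m 1 m) (0\<^sub>m m 1) U3"
  have F: "F \<in> carrier_mat ?n ?n" using U3 by (auto simp: F_def)
  have adj0: "mat_adjoint (0\<^sub>m k l :: complex mat) = 0\<^sub>m l k" for k l by (rule eq_matI) auto
  have F': "mat_adjoint F = four_block_mat (1\<^sub>m 1) (0\<^sub>m 1 m) (0\<^sub>m m 1) (mat_adjoint U3)"
    unfolding F_def using U3 by (subst mat_adjoint_four_block[of _ 1 1 _ m _ m]) (auto simp: adj0)
  note four = mult_four_block_mat[of _ 1 1 _ m _ m _ _ 1 _ m]
  have FF: "mat_adjoint F * F = 1\<^sub>m ?n"
    unfolding F' unfolding F_def using U3
    by (subst four) (auto intro!: eq_matI simp: four_block_mat_def Let_def)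
  have FAF: "mat_adjoint F * A' * F = mat_diag ?n (case_nat e f)"
  proof -
    have "mat_adjoint F * A' = four_block_mat E (0\<^sub>m 1 m) (0\<^sub>m m 1) (mat_adjoint U3 * A3)"
      unfolding F' blk using U3 A3 E by (subst four) auto
    then have "mat_adjoint F * A' * F = four_block_mat E (0\<^sub>m 1 m) (0\<^sub>m m 1) (mat_diag m f)"
      unfolding F_def using U3 A3 E by simp (subst four; auto)
    also have "\<dots> = mat_diag ?n (case_nat e f)"
      by (rule eq_matI) (auto simp: mat_diag_def E_def split: nat.splits)
    finally show ?thesis .
  qed
  show ?case
  proof (intro exI conjI)
    show "W * F \<in> carrier_mat ?n ?n" using W(1) F by auto
    have adj: "mat_adjoint (W * F) = mat_adjoint F * mat_adjoint W"
      using W(1) F by (auto simp: mat_adjoint_mult)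
    have "mat_adjoint (W * F) * (W * F) = mat_adjoint F * (mat_adjoint W * W) * F"
      unfolding adj using W(1) F by (auto simp: mat_mult_assoc)
    then show "mat_adjoint (W * F) * (W * F) = 1\<^sub>m ?n" using W F FF by simp
    have "mat_adjoint (W * F) * A * (W * F) = mat_adjoint F * A' * F"
      unfolding adj A'_def using W(1) F A by (auto simp: mat_mult_assoc)
    then show "mat_adjoint (W * F) * A * (W * F) = mat_diag ?n (case_nat e f)" using FAF by simp
  qed
qed

text \<open>The diagonal matrix equals its own adjoint, so its entries are real; the second
  unitarity equation holds because a one-sided inverse of a square matrix is two-sided.\<close>

lemma hermitian_spectral:
  fixes A :: "complex mat"
  assumes A: "A \<in> carrier_mat n n" "mat_adjoint A = A"
  obtains U f where "U \<in> carrier_mat n n" "mat_adjoint U * U = 1\<^sub>m n" "U * mat_adjoint U = 1\<^sub>m n"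
    "A = U * mat_diag n (\<lambda>i. complex_of_real (f i)) * mat_adjoint U"
proof -
  obtain U g where U: "U \<in> carrier_mat n n" "mat_adjoint U * U = 1\<^sub>m n"
    "mat_adjoint U * A * U = mat_diag n g"
    using hermitian_diagonalisation[OF A] by blast
  have UU: "U * mat_adjoint U = 1\<^sub>m n"
    by (rule mat_mult_left_right_inverse[OF _ U(1) U(2)]) (use U in simp)
  have "mat_adjoint (mat_adjoint U * A * U) = mat_adjoint U * A * U"
    using U(1) A by (auto simp: mat_adjoint_mult mat_mult_assoc)
  then have "mat_diag n (\<lambda>i. cnj (g i)) = mat_diag n g" unfolding U(3) mat_adjoint_mat_diag .
  then have re: "g i = complex_of_real (Re (g i))" if "i < n" for i
    using mat_diag_eqD[OF _ that] by (metis Reals_cnj_iff complex_is_Real_iff of_real_Re)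
  have "U * (mat_adjoint U * A * U) * mat_adjoint U
      = (U * mat_adjoint U) * A * (U * mat_adjoint U)"
    using U(1) A by (auto simp: mat_mult_assoc)
  then have "A = U * mat_diag n g * mat_adjoint U" unfolding U(3) UU using A by simp
  also have "mat_diag n g = mat_diag n (\<lambda>i. complex_of_real (Re (g i)))"
    using re by (intro eq_matI) (auto simp: mat_diag_def)
  finally show ?thesis by (rule that[OF U(1,2) UU])
qed

section \<open>Positive semidefinite matrices, the matrix absolute value and trace distance\<close>

lemma unitary_conj_index:
  assumes "U \<in> carrier_mat n n" "i < n" "j < n"
  shows "(U * mat_diag n f * mat_adjoint U) $$ (i, j)
    = (\<Sum>k<n. U $$ (i, k) * f k * cnj (U $$ (j, k)))"
  using assms
  by (subst mat_mult_index_sum) (auto simp: mat_diag_mult_right[of _ n n] intro!: sum.cong)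

lemma unitary_conj_adjoint:
  assumes U: "U \<in> carrier_mat n n"
  shows "mat_adjoint (U * mat_diag n (\<lambda>i. complex_of_real (f i)) * mat_adjoint U)
    = U * mat_diag n (\<lambda>i. complex_of_real (f i)) * mat_adjoint U"
  using U by (auto simp: mat_adjoint_mult mat_adjoint_mat_diag mat_mult_assoc)

lemma unitary_conj_mult:
  assumes U: "U \<in> carrier_mat n n" "mat_adjoint U * U = 1\<^sub>m n"
  shows "(U * mat_diag n f * mat_adjoint U) * (U * mat_diag n g * mat_adjoint U)
    = U * mat_diag n (\<lambda>i. f i * g i) * mat_adjoint U"
proof -
  have "(U * mat_diag n f * mat_adjoint U) * (U * mat_diag n g * mat_adjoint U)
    = U * mat_diag n f * (mat_adjoint U * U) * mat_diag n g * mat_adjoint U"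
    using U(1) by (auto simp: mat_mult_assoc)
  also have "\<dots> = U * (mat_diag n f * mat_diag n g) * mat_adjoint U"
    unfolding U(2) using U(1) by (auto simp: mat_mult_assoc simp del: mat_diag_diag)
  finally show ?thesis by simp
qed

lemma psd_unitary_conj:
  assumes U: "U \<in> carrier_mat n n" and f: "\<And>i. i < n \<Longrightarrow> 0 \<le> f i"
  shows "psd_mat (U * mat_diag n (\<lambda>i. complex_of_real (f i)) * mat_adjoint U)"
proof -
  let ?D = "mat_diag n (\<lambda>i. complex_of_real (f i))"
  let ?A = "U * ?D * mat_adjoint U"
  have A: "?A \<in> carrier_mat n n" using U by auto
  have "0 \<le> Re ((?A *\<^sub>v v) \<bullet>c v)" if v: "v \<in> carrier_vec n" for v
  proof -
    \<comment> \<open>The inner product of \<open>v\<close> with column \<open>k\<close> of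
      \<open>U\<close>; the form becomes the sum of
      \<open>f k * (cmod (c k))\<^sup>2\<close>.\<close>
    define c where "c k = (\<Sum>j<n. cnj (U $$ (j, k)) * v $ j)" for k
    have "(?A *\<^sub>v v) \<bullet>c v = (\<Sum>i<n. (\<Sum>j<n. ?A $$ (i, j) * v $ j) * cnj (v $ i))"
      using A v by (auto simp: scalar_prod_def atLeast0LessThan simp del: index_mult_mat(1) intro!: sum.cong)
    also have "\<dots> = (\<Sum>i<n. \<Sum>j<n. \<Sum>k<n. U $$ (i, k) * f k * cnj (U $$ (j, k)) * v $ j * cnj (v $ i))"
      using U by (intro sum.cong refl) (simp add: unitary_conj_index sum_distrib_right del: index_mult_mat(1))
    also have "\<dots> = (\<Sum>i<n. \<Sum>k<n. \<Sum>j<n. U $$ (i, k) * f k * cnj (U $$ (j, k)) * v $ j * cnj (v $ i))"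
      by (intro sum.cong refl sum.swap)
    also have "\<dots> = (\<Sum>k<n. \<Sum>i<n. \<Sum>j<n. U $$ (i, k) * f k * cnj (U $$ (j, k)) * v $ j * cnj (v $ i))"
      by (rule sum.swap)
    also have "\<dots> = (\<Sum>k<n. f k * (c k * cnj (c k)))"
      by (intro sum.cong refl, simp add: c_def sum_distrib_left sum_distrib_right mult_ac)
    also have "\<dots> = complex_of_real (\<Sum>k<n. f k * (cmod (c k))\<^sup>2)"
      by (simp add: complex_norm_square[symmetric])
    finally show ?thesis using f by (auto intro!: sum_nonneg)
  qed
  then show ?thesis using A unitary_conj_adjoint[OF U] by (auto simp: psd_mat_def hermitian_mat_def square_mat.simps)
qed

text \<open>Column \<open>i\<close> of \<open>U\<close> is a unit eigenvector, so the quadratic form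
  takes the value \<open>f i\<close> there.\<close>

lemma psd_spectral:
  assumes B: "B \<in> carrier_mat n n" "psd_mat B"
  obtains U f where "U \<in> carrier_mat n n" "mat_adjoint U * U = 1\<^sub>m n" "U * mat_adjoint U = 1\<^sub>m n"
    "B = U * mat_diag n (\<lambda>i. complex_of_real (f i)) * mat_adjoint U" "\<And>i. i < n \<Longrightarrow> 0 \<le> f i"
proof -
  have "mat_adjoint B = B" using B by (auto simp: psd_mat_def hermitian_mat_def)
  then obtain U f where U: "U \<in> carrier_mat n n" "mat_adjoint U * U = 1\<^sub>m n" "U * mat_adjoint U = 1\<^sub>m n"
    and Beq: "B = U * mat_diag n (\<lambda>i. complex_of_real (f i)) * mat_adjoint U"
    using hermitian_spectral[OF B(1)] by metis
  have "0 \<le> f i" if i: "i < n" for i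
  proof -
    let ?u = "col U i"
    have "B * U = U * mat_diag n (\<lambda>i. complex_of_real (f i)) * (mat_adjoint U * U)"
      unfolding Beq using U(1) by (auto simp: mat_mult_assoc)
    then have BU: "B * U = mat n n (\<lambda>(i, j). U $$ (i, j) * complex_of_real (f j))"
      unfolding U(2) using U(1) by (simp add: mat_diag_mult_right[of _ n n])
    have "B *\<^sub>v ?u = col (B * U) i" using B U(1) i by (subst col_mult2[of _ n n _ n]) auto
    also have "\<dots> = complex_of_real (f i) \<cdot>\<^sub>v ?u"
      unfolding BU using U(1) i by (intro eq_vecI) auto
    finally have "(B *\<^sub>v ?u) \<bullet>c ?u = complex_of_real (f i) * (?u \<bullet>c ?u)" using U(1) by simp
    also have "?u \<bullet>c ?u = (mat_adjoint U * U) $$ (i, i)"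
      using U(1) i by (auto simp: scalar_prod_def mult.commute intro!: sum.cong)
    also have "\<dots> = 1" unfolding U(2) using i by simp
    finally have "f i = Re ((B *\<^sub>v ?u) \<bullet>c ?u)" by simp
    then show ?thesis using B U(1) by (auto simp: psd_mat_def)
  qed
  then show ?thesis using that[OF U Beq] by blast
qed

text \<open>The matrix \<open>W = mat_adjoint U * V\<close> intertwines the squared diagonals.
  Wherever \<open>W $$ (i, j)\<close> is nonzero this forces \<open>f i * f i = g j * g j\<close>,
  hence \<open>f i = g j\<close> by nonnegativity. So \<open>W\<close> also intertwines the
  diagonals themselves, which is \<open>B = C\<close> in other coordinates.\<close>

lemma psd_sqrt_unique:
  assumes B: "B \<in> carrier_mat n n" "psd_mat B" and C: "C \<in> carrier_mat n n" "psd_mat C"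
    and eq: "B * B = C * C"
  shows "B = C"
proof -
  obtain U f where U: "U \<in> carrier_mat n n" "mat_adjoint U * U = 1\<^sub>m n" "U * mat_adjoint U = 1\<^sub>m n"
    and Beq: "B = U * mat_diag n (\<lambda>i. complex_of_real (f i)) * mat_adjoint U"
    and f: "\<And>i. i < n \<Longrightarrow> 0 \<le> f i"
    using psd_spectral[OF B] by metis
  obtain V g where V: "V \<in> carrier_mat n n" "mat_adjoint V * V = 1\<^sub>m n" "V * mat_adjoint V = 1\<^sub>m n"
    and Ceq: "C = V * mat_diag n (\<lambda>i. complex_of_real (g i)) * mat_adjoint V"
    and g: "\<And>i. i < n \<Longrightarrow> 0 \<le> g i"
    using psd_spectral[OF C] by metis
  define W where "W = mat_adjoint U * V"
  have W: "W \<in> carrier_mat n n" using U(1) V(1) by (auto simp: W_def)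
  note assoc = mat_mult_assoc
  have conj: "mat_adjoint U * (U * D * mat_adjoint U) * V = D * W"
    if "D \<in> carrier_mat n n" for D
  proof -
    have "mat_adjoint U * (U * D * mat_adjoint U) * V = (mat_adjoint U * U) * D * W"
      unfolding W_def using U(1) V(1) that by (auto simp: assoc)
    then show ?thesis unfolding U(2) using that W by simp
  qed
  have conj': "mat_adjoint U * (V * D * mat_adjoint V) * V = W * D"
    if "D \<in> carrier_mat n n" for D
  proof -
    have "mat_adjoint U * (V * D * mat_adjoint V) * V = W * D * (mat_adjoint V * V)"
      unfolding W_def using U(1) V(1) that by (auto simp: assoc)
    then show ?thesis unfolding V(2) using that W by simp
  qed
  let ?D = "\<lambda>h. mat_diag n (\<lambda>i. complex_of_real (h i))"
  have "B * B = U * ?D (\<lambda>i. f i * f i) * mat_adjoint U"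
    unfolding Beq unitary_conj_mult[OF U(1,2)] by simp
  moreover have "C * C = V * ?D (\<lambda>i. g i * g i) * mat_adjoint V"
    unfolding Ceq unitary_conj_mult[OF V(1,2)] by simp
  ultimately have "?D (\<lambda>i. f i * f i) * W = W * ?D (\<lambda>i. g i * g i)"
    using eq conj[of "?D (\<lambda>i. f i * f i)"] conj'[of "?D (\<lambda>i. g i * g i)"] by simp
  then have sq: "complex_of_real (f i * f i) * W $$ (i, j) = W $$ (i, j) * complex_of_real (g j * g j)"
    if "i < n" "j < n" for i j
    using that
    unfolding mat_diag_mult_left[OF W] mat_diag_mult_right[OF W]
    by (auto dest!: arg_cong[where f = "\<lambda>M. M $$ (i, j)"])
  have lin: "complex_of_real (f i) * W $$ (i, j) = W $$ (i, j) * complex_of_real (g j)"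
    if "i < n" "j < n" for i j
  proof (cases "W $$ (i, j) = 0")
    case False
    then have "f i * f i = g j * g j"
      using sq[OF that] by (metis mult.commute mult_cancel_left of_real_eq_iff)
    then have "f i = g j" using f[OF that(1)] g[OF that(2)] by (metis real_sqrt_abs2 abs_of_nonneg)
    then show ?thesis by simp
  qed simp
  have DW: "?D f * W = W * ?D g"
    unfolding mat_diag_mult_left[OF W] mat_diag_mult_right[OF W] using lin by (intro eq_matI) auto
  have "mat_adjoint U * B * V = mat_adjoint U * C * V"
    unfolding Beq Ceq using conj[of "?D f"] conj'[of "?D g"] DW by simp
  then have "U * (mat_adjoint U * B * V) * mat_adjoint V = U * (mat_adjoint U * C * V) * mat_adjoint V"
    by simp
  then have "(U * mat_adjoint U) * B * (V * mat_adjoint V) = (U * mat_adjoint U) * C * (V * mat_adjoint V)"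
    using U(1) V(1) B(1) C(1) by (auto simp: assoc)
  then show ?thesis unfolding U(3) V(3) using B(1) C(1) by simp
qed

lemma mat_abs_hermitian:
  assumes U: "U \<in> carrier_mat n n" "mat_adjoint U * U = 1\<^sub>m n"
    and Aeq: "A = U * mat_diag n (\<lambda>i. complex_of_real (f i)) * mat_adjoint U"
  shows "mat_abs A = U * mat_diag n (\<lambda>i. complex_of_real \<bar>f i\<bar>) * mat_adjoint U"
proof -
  let ?B = "U * mat_diag n (\<lambda>i. complex_of_real \<bar>f i\<bar>) * mat_adjoint U"
  have A: "A \<in> carrier_mat n n" using U(1) by (auto simp: Aeq)
  have B: "?B \<in> carrier_mat n n" "psd_mat ?B" using U(1) by (auto intro: psd_unitary_conj)
  have "mat_adjoint A * A = A * A" unfolding Aeq unitary_conj_adjoint[OF U(1)] ..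
  also have "\<dots> = ?B * ?B"
    unfolding Aeq unitary_conj_mult[OF U] by (simp flip: of_real_mult)
  finally have sq: "mat_adjoint A * A = ?B * ?B" .
  show ?thesis unfolding mat_abs_def
  proof (rule the_equality)
    show "?B \<in> carrier_mat (dim_col A) (dim_col A) \<and> psd_mat ?B \<and> ?B * ?B = mat_adjoint A * A"
      using A B sq by simp
  next
    fix C assume "C \<in> carrier_mat (dim_col A) (dim_col A) \<and> psd_mat C \<and> C * C = mat_adjoint A * A"
    then have "C \<in> carrier_mat n n" "psd_mat C" "C * C = ?B * ?B" using A sq by simp_all
    then show "C = ?B" using B by (intro psd_sqrt_unique[of C n]) simp_all
  qed
qed

text \<open>A measurement in the standard basis cannot separate states better than trace distance
  allows. For the difference \<open>D\<close>, the triangle inequality in its spectral expansion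
  bounds each diagonal entry by that of \<open>mat_abs D\<close>, and these add up to the trace; the
  factor 2 undoes the half in \<open>trace_distance\<close>.\<close>

lemma sum_diag_le_trace_distance:
  assumes AB: "A \<in> carrier_mat n n" "B \<in> carrier_mat n n" "mat_adjoint A = A" "mat_adjoint B = B"
    and S: "S \<subseteq> {..<n}"
  shows "(\<Sum>i\<in>S. cmod (A $$ (i, i) - B $$ (i, i))) \<le> 2 * trace_distance A B"
proof -
  define D where "D = A - B"
  have D: "D \<in> carrier_mat n n" "mat_adjoint D = D"
    using AB by (auto simp: D_def mat_adjoint_minus[of _ n n])
  obtain U f where U: "U \<in> carrier_mat n n" "mat_adjoint U * U = 1\<^sub>m n"
    and Deq: "D = U * mat_diag n (\<lambda>i. complex_of_real (f i)) * mat_adjoint U"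
    using hermitian_spectral[OF D] by metis
  let ?B = "U * mat_diag n (\<lambda>i. complex_of_real \<bar>f i\<bar>) * mat_adjoint U"
  have abs: "mat_abs D = ?B" by (rule mat_abs_hermitian[OF U Deq])
  have Bii: "?B $$ (i, i) = complex_of_real (\<Sum>k<n. \<bar>f k\<bar> * (cmod (U $$ (i, k)))\<^sup>2)" if "i < n" for i
    unfolding unitary_conj_index[OF U(1) that that]
    by (simp add: complex_norm_square mult_ac del: of_real_power)
  have le: "cmod (D $$ (i, i)) \<le> Re (?B $$ (i, i))" if "i < n" for i
  proof -
    have "D $$ (i, i) = (\<Sum>k<n. U $$ (i, k) * complex_of_real (f k) * cnj (U $$ (i, k)))"
      unfolding Deq by (rule unitary_conj_index[OF U(1) that that])
    then have "cmod (D $$ (i, i)) \<le> (\<Sum>k<n. cmod (U $$ (i, k) * complex_of_real (f k) * cnj (U $$ (i, k))))"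
      by (simp add: norm_sum)
    also have "\<dots> = (\<Sum>k<n. \<bar>f k\<bar> * (cmod (U $$ (i, k)))\<^sup>2)"
      by (simp add: norm_mult power2_eq_square mult_ac)
    finally show ?thesis unfolding Bii[OF that] by simp
  qed
  have "(\<Sum>i\<in>S. cmod (A $$ (i, i) - B $$ (i, i))) = (\<Sum>i\<in>S. cmod (D $$ (i, i)))"
    using S AB by (intro sum.cong refl) (auto simp: D_def)
  also have "\<dots> \<le> (\<Sum>i<n. cmod (D $$ (i, i)))" using S by (intro sum_mono2) auto
  also have "\<dots> \<le> (\<Sum>i<n. Re (?B $$ (i, i)))" using le by (intro sum_mono) auto
  also have "\<dots> = Re (mat_trace (mat_abs D))"
    unfolding abs mat_trace_def using U by simp
  finally show ?thesis by (simp add: trace_distance_def D_def)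
qed

section \<open>Computing the rows\<close>

text \<open>The bound 8 says that a loaded constant has at most 3 bits; this is why bit bounds are
  required to be at least 3 below.\<close>

fun straight :: "prog \<Rightarrow> bool" where
  "straight (Seq P Q) \<longleftrightarrow> straight P \<and> straight Q"
| "straight (If r P Q) \<longleftrightarrow> straight P \<and> straight Q"
| "straight (While r P) \<longleftrightarrow> False"
| "straight (Load r v) \<longleftrightarrow> \<bar>v\<bar> < 8"
| "straight P \<longleftrightarrow> True"

text \<open>Big-step semantics as a function, so that straight-line code is executed by
  simplification. The value on \<open>While\<close> is a dummy.\<close>

fun result :: "bool list \<Rightarrow> prog \<Rightarrow> store \<Rightarrow> store" where
  "result w Skip s = s"
| "result w (Load r v) s = s(r := v)"
| "result w (Calc r a f b) s = s(r := arith_op f (s a) (s b))"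
| "result w (ReadBit r a) s = s(r := word_bit w (s a))"
| "result w (Seq P Q) s = result w Q (result w P s)"
| "result w (If r P Q) s = (if s r > 0 then result w P s else result w Q s)"
| "result w (While r P) s = s"

fun prog_size :: "prog \<Rightarrow> nat" where
  "prog_size (Seq P Q) = prog_size P + prog_size Q"
| "prog_size (If r P Q) = 1 + prog_size P + prog_size Q"
| "prog_size P = 1"

fun sequence :: "prog list \<Rightarrow> prog" where
  "sequence [] = Skip"
| "sequence (P # Ps) = Seq P (sequence Ps)"

definition fits :: "nat \<Rightarrow> store \<Rightarrow> bool" where
  "fits B s \<longleftrightarrow> (\<forall>r. \<bar>s r\<bar> < 2 ^ B)"

lemma fits_mono: "fits B s \<Longrightarrow> B \<le> C \<Longrightarrow> fits C s"
  unfolding fits_def by (meson le_less_trans less_le_trans one_le_numeral power_increasing order_less_le_trans)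

lemma fits_upd: "fits B s \<Longrightarrow> \<bar>v\<bar> < 2 ^ B \<Longrightarrow> fits B (s(r := v))"
  by (simp add: fits_def)

lemma bit_length_le:
  assumes "\<bar>v\<bar> < 2 ^ B"
  shows "bit_length v \<le> B"
proof -
  have "nat \<bar>v\<bar> < 2 ^ B" using assms by (simp add: nat_less_iff)
  then show ?thesis unfolding bit_length_def by (intro floorlog_leI) auto
qed

lemma fits_bit_length: "fits B s \<Longrightarrow> bit_length (s r) \<le> B"
  by (simp add: fits_def bit_length_le)

lemma abs_div_le: "\<bar>a div b\<bar> \<le> \<bar>a :: int\<bar>"
proof -
  have *: "\<bar>a div b\<bar> \<le> \<bar>a\<bar>" if b: "b > 0" for a b :: int
  proof -
    define q where "q = a div b"
    have a: "a = b * q + a mod b" "0 \<le> a mod b" "a mod b < b" using b by (auto simp: q_def)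
    show ?thesis
    proof (cases "0 \<le> q")
      case True
      then have "1 * q \<le> b * q" using b by (intro mult_right_mono) auto
      then show ?thesis using a True unfolding q_def[symmetric] by linarith
    next
      case False
      then have "b * (q + 1) \<le> 1 * (q + 1)" using b by (intro mult_right_mono_neg) auto
      then have "b * q + b \<le> q + 1" by (simp add: algebra_simps)
      then show ?thesis using a False unfolding q_def[symmetric] by linarith
    qed
  qed
  consider "b > 0" | "b = 0" | "- b > 0" by linarith
  then show ?thesis
  proof cases
    case 3
    then show ?thesis using *[of "- b" "- a"] by simp
  qed (use * in auto)
qed

lemma arith_op_bound:
  assumes "\<bar>a\<bar> < 2 ^ B" "\<bar>b\<bar> < 2 ^ B" "1 \<le> B"
  shows "\<bar>arith_op f a b\<bar> < 2 ^ (2 * B)"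
proof -
  have p: "(2::int) ^ (2 * B) = 2 ^ B * 2 ^ B" by (simp add: power_add mult_2)
  have B2: "(2::int) \<le> 2 ^ B" using assms(3) power_increasing[of 1 B "2::int"] by simp
  have sum: "2 * (2::int) ^ B \<le> 2 ^ (2 * B)" unfolding p using B2 by (intro mult_right_mono) auto
  show ?thesis
  proof (cases f)
    case Times
    then show ?thesis using assms unfolding p
      by (simp add: abs_mult) (intro mult_strict_mono; simp)
  next
    case Divide
    then show ?thesis using assms(1) abs_div_le[of a b] sum by simp
  qed (use assms sum in auto)
qed

text \<open>
  A step at most doubles the bit length of the largest register, so a straight-line program, being of
  constant length, has cost linear in the bit length of its input.
\<close>

lemma straight_run:
  assumes "straight P" "fits B s" "3 \<le> B"
  shows "\<exists>T. run w P s T (result w P s) \<and> T \<le> 3 * prog_size P * 2 ^ prog_size P * B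
    \<and> fits (2 ^ prog_size P * B) (result w P s)"
  using assms
proof (induction P arbitrary: s B)
  case Skip
  then show ?case using run_Skip[of w s] unfolding result.simps prog_size.simps
    by (intro exI[of _ 1]) (auto intro: fits_mono)
next
  case (Load r v)
  then have v: "\<bar>v\<bar> < 2 ^ 3" by simp
  also have "(2::int) ^ 3 \<le> 2 ^ B" using Load by (intro power_increasing) auto
  finally have vB: "\<bar>v\<bar> < 2 ^ B" .
  have "1 + bit_length v \<le> 6 * B" using bit_length_le[OF vB] Load by simp
  moreover have "fits (2 * B) (s(r := v))"
    using fits_upd[OF Load(2) vB] by (rule fits_mono) simp
  ultimately show ?case using run_Load[of w r v s] unfolding result.simps prog_size.simps
    by (intro exI[of _ "1 + bit_length v"]) (simp del: fun_upd_apply)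
next
  case (Calc r a f b)
  have "1 + bit_length (s a) + bit_length (s b) \<le> 6 * B"
    using fits_bit_length[OF Calc(2), of a] fits_bit_length[OF Calc(2), of b] Calc(3) by linarith
  moreover have "\<bar>arith_op f (s a) (s b)\<bar> < 2 ^ (2 * B)"
    using Calc by (intro arith_op_bound) (auto simp: fits_def)
  then have "fits (2 * B) (s(r := arith_op f (s a) (s b)))"
    using Calc by (intro fits_upd) (auto intro: fits_mono)
  ultimately show ?case using run_Calc[of w r a f b s] unfolding result.simps prog_size.simps
    by (intro exI[of _ "1 + bit_length (s a) + bit_length (s b)"]) (simp del: fun_upd_apply)
next
  case (ReadBit r a)
  have "1 + bit_length (s a) \<le> 6 * B"
    using fits_bit_length[OF ReadBit(2), of a] ReadBit(3) by linarith
  moreover have "fits (2 * B) (s(r := word_bit w (s a)))"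
    using ReadBit by (intro fits_upd) (auto intro: fits_mono simp: word_bit_def)
  ultimately show ?case using run_ReadBit[of w r a s] unfolding result.simps prog_size.simps
    by (intro exI[of _ "1 + bit_length (s a)"]) (simp del: fun_upd_apply)
next
  case (Seq P Q)
  let ?p = "prog_size P" and ?q = "prog_size Q"
  obtain T where T: "run w P s T (result w P s)" "T \<le> 3 * ?p * 2 ^ ?p * B"
    "fits (2 ^ ?p * B) (result w P s)"
    using Seq.IH(1)[of B s] Seq.prems by auto
  have "3 \<le> 2 ^ ?p * B" using Seq.prems(3) by (metis le_trans mult_le_mono1 nat_mult_1 one_le_power one_le_numeral)
  then obtain T' where T': "run w Q (result w P s) T' (result w Q (result w P s))"
    "T' \<le> 3 * ?q * 2 ^ ?q * (2 ^ ?p * B)" "fits (2 ^ ?q * (2 ^ ?p * B)) (result w Q (result w P s))"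
    using Seq.IH(2)[of "2 ^ ?p * B" "result w P s"] Seq.prems T(3) by auto
  \<comment> \<open>Both halves are charged at the final bit bound \<open>2 ^ (?p + ?q) * B\<close>,
    which makes the two costs additive in the program sizes.\<close>
  have "(2::nat) ^ ?p \<le> 2 ^ (?p + ?q)" by (intro power_increasing) auto
  then have "3 * ?p * 2 ^ ?p * B \<le> 3 * ?p * 2 ^ (?p + ?q) * B" by (intro mult_le_mono) auto
  then have "T \<le> 3 * ?p * 2 ^ (?p + ?q) * B" using T(2) by linarith
  moreover have "T' \<le> 3 * ?q * 2 ^ (?p + ?q) * B" using T'(2) by (simp add: power_add mult_ac)
  ultimately have "T + T' \<le> 3 * ?p * 2 ^ (?p + ?q) * B + 3 * ?q * 2 ^ (?p + ?q) * B"
    by (rule add_mono)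
  also have "\<dots> = 3 * (?p + ?q) * 2 ^ (?p + ?q) * B" by (simp add: algebra_simps)
  finally have "T + T' \<le> 3 * (?p + ?q) * 2 ^ (?p + ?q) * B" .
  moreover have "fits (2 ^ (?p + ?q) * B) (result w (Seq P Q) s)"
    using T'(3) by (simp add: power_add mult_ac)
  moreover have "run w (Seq P Q) s (T + T') (result w (Seq P Q) s)"
    using run_Seq[OF T(1) T'(1)] by simp
  ultimately show ?case unfolding prog_size.simps by blast
next
  case (If r P Q)
  let ?p = "prog_size P" and ?q = "prog_size Q"
  let ?k = "1 + ?p + ?q"
  \<comment> \<open>Treats both branches at once, \<open>R\<close> being the one taken; the 1 that
    \<open>prog_size\<close> adds for \<open>If\<close> pays for the test.\<close>
  have main: "\<exists>T. run w (If r P Q) s T (result w R s) \<and> T \<le> 3 * ?k * 2 ^ ?k * B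
    \<and> fits (2 ^ ?k * B) (result w R s)"
    if R: "run w R s T (result w R s)" "T \<le> 3 * prog_size R * 2 ^ prog_size R * B"
      "fits (2 ^ prog_size R * B) (result w R s)" "prog_size R + 1 \<le> ?k"
      and go: "\<And>T s'. run w R s T s' \<Longrightarrow> run w (If r P Q) s (1 + T) s'" for R T
  proof -
    define K where "K = 2 ^ ?k * B"
    have "(2::nat) ^ prog_size R \<le> 2 ^ ?k" using R(4) by (intro power_increasing) auto
    then have pw: "2 ^ prog_size R * B \<le> K" unfolding K_def by (rule mult_le_mono1)
    have "3 * prog_size R * 2 ^ prog_size R * B \<le> 3 * prog_size R * K"
      unfolding mult.assoc by (intro mult_le_mono order_refl pw)
    then have "T \<le> 3 * prog_size R * K" using R(2) by linarith
    moreover have "1 \<le> K" using If.prems(3) by (simp add: K_def Suc_le_eq)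
    ultimately have "1 + T \<le> 3 * (prog_size R + 1) * K" by (simp add: algebra_simps)
    also have "\<dots> \<le> 3 * ?k * K" using R(4) by (intro mult_le_mono) auto
    finally have "1 + T \<le> 3 * ?k * 2 ^ ?k * B" by (simp only: K_def mult.assoc)
    moreover have "fits (2 ^ ?k * B) (result w R s)"
      using R(3) pw unfolding K_def by (rule fits_mono)
    ultimately show ?thesis using go[OF R(1)] by blast
  qed
  show ?case
  proof (cases "s r > 0")
    case True
    obtain T where "run w P s T (result w P s)" "T \<le> 3 * ?p * 2 ^ ?p * B"
      "fits (2 ^ ?p * B) (result w P s)" using If.IH(1)[of B s] If.prems by auto
    moreover have "result w (If r P Q) s = result w P s" using True by simp
    ultimately show ?thesis using main[of P T] run_If_pos[where s = s and r = r, OF True]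
      unfolding prog_size.simps by simp
  next
    case False
    obtain T where "run w Q s T (result w Q s)" "T \<le> 3 * ?q * 2 ^ ?q * B"
      "fits (2 ^ ?q * B) (result w Q s)" using If.IH(2)[of B s] If.prems by auto
    moreover have "result w (If r P Q) s = result w Q s" using False by simp
    ultimately show ?thesis using main[of Q T] run_If_nonpos[where s = s and r = r] False
      unfolding prog_size.simps by simp
  qed
qed simp

text \<open>
  Registers 9, 10, 11 hold 0, 1, 2; register 13 holds \<open>2 ^ p\<close>; 14, 15, 16 hold \<open>i\<close>, \<open>j\<close>, \<open>N\<close> for
  the row \<open>2 * i + j\<close>. \<open>edge_code\<close> takes in 20 the lower end of an edge and in 21 the neighbouring
  rung, which is one of its two ends; it leaves the neighbour in 24. The bisection keeps the square
  root between 25 and 23, with 28 positive as long as the gap exceeds 1. Registers 3 and 6, the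
  imaginary parts, are never written.
\<close>

definition init_code :: prog where
  "init_code = sequence [Load 10 1, Load 11 2, Load 13 1]"

definition double_code :: prog where
  "double_code = Seq (Calc 13 13 Times 11) (Calc 2 2 Minus 10)"

text \<open>Prepares the edge down to rung \<open>i - 1\<close>, which is both the lower end of the
  edge and the neighbouring rung. \<open>switch_code\<close> later prepares the upward edge, whose
  lower end is \<open>i\<close> and whose neighbouring rung is \<open>i + 1\<close>.\<close>

definition locate_code :: prog where
  "locate_code = sequence [Calc 14 1 Divide 11, Calc 15 14 Times 11, Calc 15 1 Minus 15,
     Calc 16 0 Divide 11, Calc 16 16 Minus 10, Calc 20 14 Minus 10, Calc 21 14 Minus 10]"

text \<open>The XOR of two bits is the square of their difference. Register 22 receives the
  radicand: in units of \<open>1 / 2 ^ p\<close>, the weight is the square root of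
  \<open>(l + 1) * (N - l) * 4 ^ p / 4\<close>. The bisection starts between 0 and
  \<open>d * 2 ^ p\<close>.\<close>

definition edge_code :: prog where
  "edge_code = sequence [ReadBit 22 20, Calc 22 15 Minus 22, Calc 22 22 Times 22,
     Calc 24 21 Times 11, Calc 24 24 Plus 22, Calc 22 20 Plus 10, Calc 23 16 Minus 20,
     Calc 22 22 Times 23, Calc 22 22 Times 13, Calc 22 22 Times 13, Load 23 4, Calc 22 22 Divide 23,
     Load 25 0, Calc 23 0 Times 13, Calc 28 23 Minus 25, Calc 28 28 Minus 10]"

text \<open>Tests ask for positivity, so the 1 added to register 30 turns the test into
  \<open>m * m \<le> s 22\<close> for the midpoint \<open>m\<close>. Adding register 9, which is 0,
  copies a register.\<close>

definition bisect_code :: prog where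
  "bisect_code = sequence [Calc 29 25 Plus 23, Calc 29 29 Divide 11, Calc 30 29 Times 29,
     Calc 30 22 Minus 30, Calc 30 30 Plus 10, If 30 (Calc 25 29 Plus 9) (Calc 23 29 Plus 9),
     Calc 28 23 Minus 25, Calc 28 28 Minus 10]"

definition switch_code :: prog where
  "switch_code = sequence [Calc 26 24 Plus 9, Calc 27 25 Plus 9, Calc 20 14 Plus 9, Calc 21 14 Plus 10]"

definition output_code :: prog where
  "output_code = sequence [Calc 31 16 Minus 14,
     If 31
       (sequence [Calc 1 24 Plus 9, Calc 2 25 Plus 9, Load 0 1,
          If 14 (sequence [Calc 4 26 Plus 9, Calc 5 27 Plus 9, Load 0 2]) Skip])
       (sequence [Calc 1 26 Plus 9, Calc 2 27 Plus 9, Load 0 1])]"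

definition row_code :: prog where
  "row_code = Seq init_code (Seq (While 2 double_code) (Seq locate_code
     (Seq edge_code (Seq (While 28 bisect_code) (Seq switch_code
     (Seq edge_code (Seq (While 28 bisect_code) output_code)))))))"

section \<open>Running time and result of the row program\<close>

text \<open>Iterating \<open>straight_run\<close> would double the bit bound at every step of every
  round. An a priori bound on the final value restores \<open>fits B\<close> after each round
  instead, so each round costs at most \<open>24 * B\<close>, from size 2 of the body.\<close>

lemma run_double_loop:
  assumes "s 2 = int p" "s 10 = 1" "s 11 = 2" "fits B s" "3 \<le> B" "0 \<le> s 13" "s 13 * 2 ^ p < 2 ^ B"
  shows "\<exists>T. run w (While 2 double_code) s T (s(13 := s 13 * 2 ^ p, 2 := 0))
    \<and> T \<le> (p + 1) * (1 + 24 * B)"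
  using assms
proof (induction p arbitrary: s)
  case 0
  have "s(13 := s 13 * 2 ^ 0, 2 := 0) = s" using 0(1) by (auto simp: fun_eq_iff)
  then show ?case using run_While_nonpos[of s 2 w double_code] 0(1) by (intro exI[of _ 1]) auto
next
  case (Suc p)
  let ?s = "s(13 := s 13 * 2, 2 := int p)"
  have res: "result w double_code s = ?s" using Suc.prems by (simp add: double_code_def)
  have sd: "straight double_code" "prog_size double_code = 2" by (simp_all add: double_code_def)
  obtain T where T: "run w double_code s T ?s" "T \<le> 24 * B"
    using straight_run[OF sd(1) Suc.prems(4,5), of w] unfolding res sd by auto
  have "\<bar>int p\<bar> \<le> \<bar>s 2\<bar>" using Suc.prems(1) by simp
  also have "\<dots> < 2 ^ B" using Suc.prems(4) by (simp add: fits_def)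
  finally have pB: "\<bar>int p\<bar> < 2 ^ B" .
  have "s 13 * 2 * 1 \<le> s 13 * 2 * 2 ^ p" using Suc.prems(6) by (intro mult_left_mono) auto
  also have "\<dots> < 2 ^ B" using Suc.prems(7) by simp
  finally have qB: "\<bar>s 13 * 2\<bar> < 2 ^ B" using Suc.prems(6) by simp
  have fs: "fits B ?s" using Suc.prems(4) qB pB by (intro fits_upd) auto
  have next_s: "?s 2 = int p" "?s 10 = 1" "?s 11 = 2" "0 \<le> ?s 13" "?s 13 * 2 ^ p < 2 ^ B"
    using Suc.prems by simp_all
  obtain T' where T': "run w (While 2 double_code) ?s T' (?s(13 := ?s 13 * 2 ^ p, 2 := 0))"
    "T' \<le> (p + 1) * (1 + 24 * B)"
    using Suc.IH[OF next_s(1-3) fs Suc.prems(5) next_s(4,5)] by blast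
  have eq: "?s(13 := ?s 13 * 2 ^ p, 2 := 0) = s(13 := s 13 * 2 ^ Suc p, 2 := 0)"
    by (auto simp: fun_eq_iff)
  have "run w (While 2 double_code) s (1 + T + T') (s(13 := s 13 * 2 ^ Suc p, 2 := 0))"
    using run_While_pos[OF _ T(1) T'(1), unfolded eq] Suc.prems(1) by simp
  moreover have "1 + T + T' \<le> (Suc p + 1) * (1 + 24 * B)" using T(2) T'(2) by simp
  ultimately show ?case by blast
qed

definition agree :: "nat set \<Rightarrow> store \<Rightarrow> store \<Rightarrow> bool" where
  "agree R s s' \<longleftrightarrow> (\<forall>r. r \<notin> R \<longrightarrow> s' r = s r)"

text \<open>Again an invariant restores the bit bound after each round. Only register 30, which
  contains the square of the midpoint, needs \<open>2 * B + 2\<close> bits; the interval ends stay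
  below \<open>2 ^ B\<close>. The gap halves, so \<open>k\<close> counts rounds, and 11 is the size
  of the body.\<close>

lemma run_bisect_loop:
  assumes "s 9 = 0" "s 10 = 1" "s 11 = 2" "s 28 = s 23 - s 25 - 1"
    and "fits (2 * B + 2) s" "3 \<le> B" "0 \<le> s 25" "s 25 < s 23" "s 23 < 2 ^ B" "\<bar>s 22\<bar> < 2 ^ B"
    and "(s 25)\<^sup>2 \<le> s 22" "s 22 < (s 23)\<^sup>2" "s 23 - s 25 \<le> 2 ^ k"
  shows "\<exists>T s'. run w (While 28 bisect_code) s T s' \<and>
    T \<le> (k + 1) * (1 + 3 * 11 * 2 ^ 11 * (2 * B + 2)) \<and>
    fits (2 * B + 2) s' \<and> agree {23, 25, 28, 29, 30} s s' \<and>
    0 \<le> s' 25 \<and> (s' 25)\<^sup>2 \<le> s 22 \<and> s 22 < (s' 25 + 1)\<^sup>2"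
  using assms
proof (induction k arbitrary: s)
  case 0
  then have "s 28 \<le> 0" "s 23 = s 25 + 1" by auto
  then show ?case using 0 run_While_nonpos[of s 28 w bisect_code]
    by (intro exI[of _ 1] exI[of _ s]) (auto simp: agree_def)
next
  case (Suc k)
  show ?case
  proof (cases "s 28 > 0")
    case False
    have eq: "s 23 = s 25 + 1" using Suc.prems False by auto
    show ?thesis using Suc.prems(5-11) Suc.prems(12)[unfolded eq] False run_While_nonpos[of s 28 w bisect_code]
      by (intro exI[of _ 1] exI[of _ s]) (auto simp: agree_def)
  next
    case True
    define m where "m = (s 25 + s 23) div 2"
    have m: "s 25 < m" "m < s 23" using True Suc.prems(4) unfolding m_def by linarith+
    define lo where "lo = (if m\<^sup>2 \<le> s 22 then m else s 25)"
    define hi where "hi = (if m\<^sup>2 \<le> s 22 then s 23 else m)"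
    let ?s = "s(29 := m, 30 := s 22 - m * m + 1, 25 := lo, 23 := hi, 28 := hi - lo - 1)"
    have res: "result w bisect_code s = ?s"
      using Suc.prems(1-3) by (auto simp: bisect_code_def m_def lo_def hi_def fun_eq_iff power2_eq_square)
    have sb: "straight bisect_code" "prog_size bisect_code = 11" by (simp_all add: bisect_code_def)
    have "3 \<le> 2 * B + 2" using Suc.prems(6) by simp
    then obtain T where T: "run w bisect_code s T ?s" "T \<le> 3 * 11 * 2 ^ 11 * (2 * B + 2)"
      using straight_run[OF sb(1) Suc.prems(5), of w] unfolding res sb by blast
    have mB: "0 \<le> m" "m < 2 ^ B" using m Suc.prems(7,9) by auto
    have lohi: "0 \<le> lo" "lo < hi" "hi < 2 ^ B" "lo\<^sup>2 \<le> s 22" "s 22 < hi\<^sup>2"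
      using m mB Suc.prems(7-12) by (auto simp: lo_def hi_def)
    \<comment> \<open>The upper half of an odd gap is the longer one, but \<open>2 * 2 ^ k\<close>
      is even, so rounding does no harm.\<close>
    have half: "hi - lo \<le> 2 ^ k"
    proof -
      have "2 * (a div 2) \<le> a \<and> a \<le> 2 * (a div 2) + 1" for a :: int by presburger
      then have "2 * m \<le> s 25 + s 23" "s 25 + s 23 \<le> 2 * m + 1" unfolding m_def by blast+
      moreover have "s 23 - s 25 \<le> 2 * 2 ^ k" using Suc.prems(13) by simp
      ultimately have "m - s 25 \<le> 2 ^ k" "s 23 - m \<le> 2 ^ k" by linarith+
      then show ?thesis unfolding lo_def hi_def by simp
    qed
    have "2 * B + 2 = B + B + 2" by simp
    then have pow: "(2::int) ^ (2 * B + 2) = 4 * (2 ^ B * 2 ^ B)" by (simp only: power_add) simp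
    have one: "(1::int) \<le> 2 ^ B" by simp
    have le: "(2::int) ^ B \<le> 2 ^ B * 2 ^ B" using mult_left_mono[OF one, of "2 ^ B"] by simp
    have small: "\<bar>v\<bar> < 2 ^ (2 * B + 2)" if "\<bar>v\<bar> < 2 ^ B" for v :: int
      using that le one unfolding pow by linarith
    have mm: "m * m < 2 ^ B * 2 ^ B" "0 \<le> m * m" using mB by (auto intro!: mult_strict_mono)
    have new: "\<bar>s 22 - m * m + 1\<bar> < 2 ^ (2 * B + 2)"
      using Suc.prems(10) mm le one unfolding pow by linarith
    have fits: "fits (2 * B + 2) ?s"
      by (intro fits_upd Suc.prems(5) new; rule small) (use mB lohi in linarith)+
    have next_s: "?s 9 = 0" "?s 10 = 1" "?s 11 = 2" "?s 28 = ?s 23 - ?s 25 - 1"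
      "0 \<le> ?s 25" "?s 25 < ?s 23" "?s 23 < 2 ^ B" "\<bar>?s 22\<bar> < 2 ^ B"
      "(?s 25)\<^sup>2 \<le> ?s 22" "?s 22 < (?s 23)\<^sup>2" "?s 23 - ?s 25 \<le> 2 ^ k"
      using lohi half Suc.prems by simp_all
    have s22: "?s 22 = s 22" by simp
    obtain T' s' where T': "run w (While 28 bisect_code) ?s T' s'"
      "T' \<le> (k + 1) * (1 + 3 * 11 * 2 ^ 11 * (2 * B + 2))" "fits (2 * B + 2) s'"
      "agree {23, 25, 28, 29, 30} ?s s'" "0 \<le> s' 25" "(s' 25)\<^sup>2 \<le> s 22" "s 22 < (s' 25 + 1)\<^sup>2"
      using Suc.IH[OF next_s(1-4) fits Suc.prems(6) next_s(5-11)] unfolding s22 by blast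
    have "run w (While 28 bisect_code) s (1 + T + T') s'"
      using run_While_pos[OF True T(1) T'(1)] .
    moreover have "1 + T + T' \<le> (Suc k + 1) * (1 + 3 * 11 * 2 ^ 11 * (2 * B + 2))"
      using T(2) T'(2) by simp
    moreover have "agree {23, 25, 28, 29, 30} s s'" using T'(4) by (simp add: agree_def)
    ultimately show ?thesis using T' by blast
  qed
qed

text \<open>The values \<open>l = -1\<close> and \<open>l = N\<close> stand for the missing edges at
  the two ends of the ladder. There \<open>word_bit\<close> reads 0 out of range and the radicand
  vanishes, so the same code runs on every row and its dummy result is discarded at output.\<close>

lemma run_edge:
  fixes l N :: int and p :: nat
  defines "A \<equiv> (l + 1) * (N - l) * 2 ^ p * 2 ^ p div 4"
  assumes s: "s 0 = 2 * (N + 1)" "s 9 = 0" "s 10 = 1" "s 11 = 2" "s 13 = 2 ^ p" "s 16 = N" "s 20 = l"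
    and l: "-1 \<le> l" "l \<le> N" "0 \<le> N" and B: "fits B s" "3 \<le> B"
  shows "\<exists>T s'. run w (Seq edge_code (While 28 bisect_code)) s T s' \<and> T \<le> 2 ^ 60 * B\<^sup>2 \<and>
    fits (2 ^ 20 * B) s' \<and> agree {22, 23, 24, 25, 28, 29, 30} s s' \<and>
    s' 24 = 2 * s 21 + (s 15 - word_bit w l)\<^sup>2 \<and>
    0 \<le> s' 25 \<and> (s' 25)\<^sup>2 \<le> A \<and> A < (s' 25 + 1)\<^sup>2"
proof -
  \<comment> \<open>17 is the size of \<open>edge_code\<close>. The bit bound also bounds the number
    of bisection rounds, whence the square of \<open>B\<close> in the cost.\<close>
  let ?B = "2 ^ 17 * B"
  define s1 where "s1 = result w edge_code s"
  have "straight edge_code" "prog_size edge_code = 17" by (simp_all add: edge_code_def)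
  with straight_run[OF this(1) B] obtain T where
    T: "run w edge_code s T s1" "T \<le> 3 * 17 * 2 ^ 17 * B" "fits ?B s1" unfolding s1_def by auto
  have s1: "s1 9 = 0" "s1 10 = 1" "s1 11 = 2" "s1 28 = s1 23 - s1 25 - 1" "s1 25 = 0"
    "s1 23 = 2 * (N + 1) * 2 ^ p" "s1 22 = A" "s1 24 = 2 * s 21 + (s 15 - word_bit w l)\<^sup>2"
    using s by (simp_all add: s1_def edge_code_def A_def power2_eq_square)
  have ag1: "agree {22, 23, 24, 25, 28, 29, 30} s s1"
    by (auto simp: agree_def s1_def edge_code_def)
  have N: "0 < N + 1" using l by linarith
  have pos: "0 < s1 23" unfolding s1 using N by simp
  have lt: "s1 23 < 2 ^ ?B" "\<bar>s1 22\<bar> < 2 ^ ?B" using T(3) by (auto simp: fits_def abs_less_iff)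
  have A0: "0 \<le> A" unfolding A_def using l by (intro div_int_pos_iff[THEN iffD2]) (simp add: mult_nonneg_nonneg)
  \<comment> \<open>The initial upper end squares to \<open>4 * (N + 1)\<^sup>2 * 4 ^ p\<close>,
    strictly above the radicand, as bisection requires.\<close>
  have "(l + 1) * (N - l) \<le> (N + 1) * (N + 1)" using l by (intro mult_mono) auto
  then have "(l + 1) * (N - l) * (2 ^ p * 2 ^ p) \<le> (N + 1) * (N + 1) * (2 ^ p * 2 ^ p)"
    by (intro mult_right_mono) auto
  moreover have "0 < (N + 1) * (N + 1) * (2 ^ p * 2 ^ p)" using N by simp
  moreover have "(s1 23)\<^sup>2 = 4 * ((N + 1) * (N + 1) * (2 ^ p * 2 ^ p))"
    unfolding s1 by (simp add: power2_eq_square algebra_simps)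
  moreover have "A \<le> (l + 1) * (N - l) * (2 ^ p * 2 ^ p)"
  proof -
    have "0 \<le> (l + 1) * (N - l) * (2 ^ p * 2 ^ p)" using l by simp
    then show ?thesis unfolding A_def mult.assoc[symmetric] by linarith
  qed
  ultimately have "s1 22 < (s1 23)\<^sup>2" unfolding s1(7) by linarith
  moreover have "s1 23 - s1 25 \<le> 2 ^ ?B" using lt(1) s1(5) by simp
  moreover have "fits (2 * ?B + 2) s1" using T(3) by (rule fits_mono) simp
  ultimately obtain T' s' where T': "run w (While 28 bisect_code) s1 T' s'"
    "T' \<le> (?B + 1) * (1 + 3 * 11 * 2 ^ 11 * (2 * ?B + 2))"
    "fits (2 * ?B + 2) s'" "agree {23, 25, 28, 29, 30} s1 s'"
    "0 \<le> s' 25" "(s' 25)\<^sup>2 \<le> A" "A < (s' 25 + 1)\<^sup>2"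
    using run_bisect_loop[of s1 ?B ?B w] s1 lt pos A0 B(2) by auto
  have "T' \<le> (2 ^ 18 * B) * (2 ^ 36 * B)"
    by (rule order_trans[OF T'(2)], intro mult_le_mono) (use B(2) in auto)
  then have "T' \<le> 2 ^ 54 * B\<^sup>2" by (simp add: power2_eq_square)
  moreover have "3 * 17 * 2 ^ 17 * B \<le> 2 ^ 23 * B\<^sup>2"
    using B(2) by (intro mult_le_mono) (simp_all add: power2_eq_square)
  moreover have "2 ^ 23 * X + 2 ^ 54 * X \<le> 2 ^ 60 * X" for X :: nat by simp
  ultimately have "T + T' \<le> 2 ^ 60 * B\<^sup>2" using T(2) by (meson add_mono order_trans)
  moreover have "run w (Seq edge_code (While 28 bisect_code)) s (T + T') s'"
    using run_Seq[OF T(1) T'(1)] .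
  moreover have "fits (2 ^ 20 * B) s'" using T'(3) by (rule fits_mono) (use B(2) in simp)
  moreover have "agree {22, 23, 24, 25, 28, 29, 30} s s'" using ag1 T'(4) by (simp add: agree_def)
  moreover have "s' 24 = 2 * s 21 + (s 15 - word_bit w l)\<^sup>2" using T'(4) s1(8) by (simp add: agree_def)
  ultimately show ?thesis using T' by blast
qed

lemma run_SeqD: "run w (Seq P Q) s T s' \<Longrightarrow> \<exists>T1 T2 s1. T = T1 + T2 \<and> run w P s T1 s1 \<and> run w Q s1 T2 s'"
  by (erule run.cases) auto

text \<open>\<open>run_edge\<close> treats an edge computation as one block, whereas
  \<open>row_code\<close> is nested to the right.\<close>

lemma run_Seq_assoc: "run w (Seq (Seq P Q) R) s T s' \<Longrightarrow> run w (Seq P (Seq Q R)) s T s'"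
proof -
  assume "run w (Seq (Seq P Q) R) s T s'"
  then obtain T1 T2 s1 where 1: "T = T1 + T2" "run w (Seq P Q) s T1 s1" "run w R s1 T2 s'"
    by (blast dest: run_SeqD)
  then obtain T3 T4 s2 where 2: "T1 = T3 + T4" "run w P s T3 s2" "run w Q s2 T4 s1"
    by (blast dest: run_SeqD)
  show ?thesis
    using run_Seq[OF 2(2) run_Seq[OF 2(3) 1(3)]] by (simp add: 1(1) 2(1) add.assoc)
qed

lemma run_row_code:
  fixes N x p :: nat
  defines "d \<equiv> 2 * (N + 1)"
  defines "i \<equiv> int (x div 2)" and "j \<equiv> int (x mod 2)"
  assumes x: "x < d"
  shows "\<exists>T s up lo. run w row_code (row_input d x p) T s \<and> T \<le> (floorlog 2 d + p + 1) ^ 300 \<and>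
    0 \<le> up \<and> up\<^sup>2 \<le> (i + 1) * (int N - i) * 2 ^ p * 2 ^ p div 4 \<and>
      (i + 1) * (int N - i) * 2 ^ p * 2 ^ p div 4 < (up + 1)\<^sup>2 \<and>
    0 \<le> lo \<and> lo\<^sup>2 \<le> i * (int N - i + 1) * 2 ^ p * 2 ^ p div 4 \<and>
      i * (int N - i + 1) * 2 ^ p * 2 ^ p div 4 < (lo + 1)\<^sup>2 \<and>
    (let y_up = 2 * (i + 1) + (j - word_bit w i)\<^sup>2; y_lo = 2 * (i - 1) + (j - word_bit w (i - 1))\<^sup>2
     in if i < int N then s 1 = y_up \<and> s 2 = up \<and> s 3 = 0 \<and>
          (if 0 < i then s 0 = 2 \<and> s 4 = y_lo \<and> s 5 = lo \<and> s 6 = 0 else s 0 = 1)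
        else s 0 = 1 \<and> s 1 = y_lo \<and> s 2 = lo \<and> s 3 = 0)"
proof -
  \<comment> \<open>The base of the permitted time. It bounds the bit lengths of \<open>d\<close>,
    \<open>x\<close> and \<open>p\<close>, and it is at least 3 because
    \<open>d \<ge> 2\<close>.\<close>
  define n where "n = floorlog 2 d + p + 1"
  define s0 where "s0 = row_input d x p"
  have d2: "2 \<le> d" by (simp add: d_def)
  have dlog: "d < 2 ^ floorlog 2 d" using floorlog_bounds[of d 2] d2 by auto
  have "(2::nat) ^ 1 < 2 ^ floorlog 2 d" unfolding power_one_right using d2 dlog by (rule le_less_trans)
  then have "1 < floorlog 2 d" by (rule power_less_imp_less_exp[rotated]) simp
  then have n3: "3 \<le> n" by (simp add: n_def)
  have mono: "(2::nat) ^ floorlog 2 d \<le> 2 ^ n" by (intro power_increasing) (auto simp: n_def)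
  have "d < 2 ^ n" "x < 2 ^ n" using dlog mono x by linarith+
  moreover have "p < 2 ^ n" using less_exp[of n] by (simp add: n_def)
  moreover have "\<bar>int k\<bar> < 2 ^ n" if "k < 2 ^ n" for k using that by simp
  ultimately have "fits n s0"
    unfolding s0_def row_input_def by (intro fits_upd) (simp_all add: fits_def)
  then obtain T1 where T1: "run w init_code s0 T1 (result w init_code s0)" "T1 \<le> 3 * 4 * 2 ^ 4 * n"
    "fits (2 ^ 4 * n) (result w init_code s0)"
    using straight_run[of init_code n s0 w] n3 by (auto simp: init_code_def)
  define s1 where "s1 = result w init_code s0"
  have s1: "s1 = s0(10 := 1, 11 := 2, 13 := 1)" by (simp add: s1_def init_code_def)
  \<comment> \<open>The bit bound left by \<open>init_code\<close> already has room for the power to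
    be built, as \<open>p < n\<close>.\<close>
  have "(2::int) ^ p < 2 ^ (2 ^ 4 * n)" by (intro power_strict_increasing) (auto simp: n_def)
  then obtain T2 where T2: "run w (While 2 double_code) s1 T2 (s1(13 := s1 13 * 2 ^ p, 2 := 0))"
    "T2 \<le> (p + 1) * (1 + 24 * (2 ^ 4 * n))"
    using run_double_loop[of s1 p "2 ^ 4 * n" w] T1(3) n3 unfolding s1_def[symmetric]
    by (auto simp: s1 s0_def row_input_def)
  define s2 where "s2 = s1(13 := s1 13 * 2 ^ p, 2 := 0)"
  have fits2: "fits (2 ^ 4 * n) s2" unfolding s2_def
    using T1(3)[folded s1_def] \<open>2 ^ p < 2 ^ (2 ^ 4 * n)\<close> by (intro fits_upd) (auto simp: s1)
  obtain T3 where T3: "run w locate_code s2 T3 (result w locate_code s2)" "T3 \<le> 3 * 8 * 2 ^ 8 * (2 ^ 4 * n)"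
    "fits (2 ^ 8 * (2 ^ 4 * n)) (result w locate_code s2)"
    using straight_run[OF _ fits2, of locate_code w] n3 by (auto simp: locate_code_def)
  define s3 where "s3 = result w locate_code s2"
  have s3: "s3 0 = 2 * (int N + 1)" "s3 9 = 0" "s3 10 = 1" "s3 11 = 2" "s3 13 = 2 ^ p" "s3 16 = int N"
    "s3 20 = i - 1" "s3 21 = i - 1" "s3 14 = i" "s3 15 = j" "s3 3 = 0" "s3 6 = 0"
    by (simp_all add: s3_def locate_code_def s2_def s1 s0_def row_input_def d_def i_def j_def)
      (simp_all add: zdiv_int zmod_int minus_mult_div_eq_mod mult.commute)
  have iN: "0 \<le> i" "i \<le> int N" using x by (auto simp: i_def d_def)
  obtain T4 s4 where T4: "run w (Seq edge_code (While 28 bisect_code)) s3 T4 s4"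
    "T4 \<le> 2 ^ 60 * (2 ^ 8 * (2 ^ 4 * n))\<^sup>2" "fits (2 ^ 20 * (2 ^ 8 * (2 ^ 4 * n))) s4"
    "agree {22, 23, 24, 25, 28, 29, 30} s3 s4"
    "s4 24 = 2 * (i - 1) + (j - word_bit w (i - 1))\<^sup>2" "0 \<le> s4 25"
    "(s4 25)\<^sup>2 \<le> i * (int N - i + 1) * 2 ^ p * 2 ^ p div 4"
    "i * (int N - i + 1) * 2 ^ p * 2 ^ p div 4 < (s4 25 + 1)\<^sup>2"
    using run_edge[of s3 "int N" p "i - 1" "2 ^ 8 * (2 ^ 4 * n)" w] s3 iN T3(3) n3
    unfolding s3_def[symmetric] by (auto simp: algebra_simps)
  let ?B4 = "2 ^ 20 * (2 ^ 8 * (2 ^ 4 * n))"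
  obtain T5 where T5: "run w switch_code s4 T5 (result w switch_code s4)" "T5 \<le> 3 * 5 * 2 ^ 5 * ?B4"
    "fits (2 ^ 5 * ?B4) (result w switch_code s4)"
    using straight_run[OF _ T4(3), of switch_code w] n3 by (auto simp: switch_code_def)
  define s5 where "s5 = result w switch_code s4"
  have s5: "s5 0 = 2 * (int N + 1)" "s5 9 = 0" "s5 10 = 1" "s5 11 = 2" "s5 13 = 2 ^ p" "s5 16 = int N"
    "s5 20 = i" "s5 21 = i + 1" "s5 14 = i" "s5 15 = j" "s5 3 = 0" "s5 6 = 0"
    "s5 26 = s4 24" "s5 27 = s4 25"
    using T4(4) s3 by (simp_all add: s5_def switch_code_def agree_def)
  obtain T6 s6 where T6: "run w (Seq edge_code (While 28 bisect_code)) s5 T6 s6"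
    "T6 \<le> 2 ^ 60 * (2 ^ 5 * ?B4)\<^sup>2" "fits (2 ^ 20 * (2 ^ 5 * ?B4)) s6"
    "agree {22, 23, 24, 25, 28, 29, 30} s5 s6"
    "s6 24 = 2 * (i + 1) + (j - word_bit w i)\<^sup>2" "0 \<le> s6 25"
    "(s6 25)\<^sup>2 \<le> (i + 1) * (int N - i) * 2 ^ p * 2 ^ p div 4"
    "(i + 1) * (int N - i) * 2 ^ p * 2 ^ p div 4 < (s6 25 + 1)\<^sup>2"
    using run_edge[of s5 "int N" p i "2 ^ 5 * ?B4" w] s5 iN T5(3) n3
    unfolding s5_def[symmetric] by auto
  let ?B6 = "2 ^ 20 * (2 ^ 5 * ?B4)"
  have so: "straight output_code" "prog_size output_code = 17" by (simp_all add: output_code_def)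
  obtain T7 where T7: "run w output_code s6 T7 (result w output_code s6)" "T7 \<le> 3 * 17 * 2 ^ 17 * ?B6"
    using straight_run[OF so(1) T6(3)] n3 unfolding so by auto
  define s7 where "s7 = result w output_code s6"
  have s6: "s6 9 = 0" "s6 16 = int N" "s6 14 = i" "s6 3 = 0" "s6 6 = 0" "s6 26 = s4 24" "s6 27 = s4 25"
    using T6(4) s5 by (simp_all add: agree_def)
  have run: "run w row_code s0 (T1 + (T2 + (T3 + (T4 + (T5 + (T6 + T7)))))) s7"
  proof -
    have "run w (Seq edge_code (Seq (While 28 bisect_code) output_code)) s5 (T6 + T7) s7"
      using run_Seq_assoc[OF run_Seq[OF T6(1) T7(1)]] unfolding s7_def .
    then have "run w (Seq switch_code (Seq edge_code (Seq (While 28 bisect_code) output_code))) s4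
      (T5 + (T6 + T7)) s7" using run_Seq T5(1) unfolding s5_def[symmetric] by blast
    then have "run w (Seq edge_code (Seq (While 28 bisect_code)
      (Seq switch_code (Seq edge_code (Seq (While 28 bisect_code) output_code))))) s3
      (T4 + (T5 + (T6 + T7))) s7"
      using run_Seq_assoc[OF run_Seq[OF T4(1)]] by blast
    then show ?thesis unfolding row_code_def
      using run_Seq[OF T1(1)[folded s1_def]
          run_Seq[OF T2(1)[folded s2_def] run_Seq[OF T3(1)[folded s3_def]]]] by blast
  qed
  have nn: "n \<le> n\<^sup>2" using n3 by (simp add: power2_eq_square)
  have "(p + 1) * (1 + 24 * (2 ^ 4 * n)) \<le> n * (2 ^ 9 * n)"
    by (intro mult_le_mono) (use n3 in \<open>auto simp: n_def\<close>)
  then have t2: "T2 \<le> 2 ^ 9 * n\<^sup>2" using T2(2) by (simp add: power2_eq_square)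
  have t1: "T1 \<le> 2 ^ 8 * n\<^sup>2" using T1(2) nn by simp
  have t3: "T3 \<le> 2 ^ 20 * n\<^sup>2" using T3(2) nn by simp
  have t4: "T4 \<le> 2 ^ 84 * n\<^sup>2" using T4(2) by (simp add: power_mult_distrib)
  have t5: "T5 \<le> 2 ^ 50 * n\<^sup>2" using T5(2) nn by simp
  have t6: "T6 \<le> 2 ^ 134 * n\<^sup>2" using T6(2) by (simp add: power_mult_distrib)
  have t7: "T7 \<le> 2 ^ 90 * n\<^sup>2" using T7(2) nn by simp
  have "T1 + (T2 + (T3 + (T4 + (T5 + (T6 + T7))))) \<le> 2 ^ 298 * n\<^sup>2"
    using t1 t2 t3 t4 t5 t6 t7 by simp
  \<comment> \<open>The constant, chosen generously, is absorbed because
    \<open>n \<ge> 2\<close>.\<close>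
  also have "\<dots> \<le> n ^ 298 * n\<^sup>2" using n3 by (intro mult_le_mono1 power_mono) auto
  also have "\<dots> = n ^ 300" by (simp flip: power_add)
  finally have cost: "T1 + (T2 + (T3 + (T4 + (T5 + (T6 + T7))))) \<le> n ^ 300" .
  have s7: "let y_up = 2 * (i + 1) + (j - word_bit w i)\<^sup>2; y_lo = 2 * (i - 1) + (j - word_bit w (i - 1))\<^sup>2
     in if i < int N then s7 1 = y_up \<and> s7 2 = s6 25 \<and> s7 3 = 0 \<and>
          (if 0 < i then s7 0 = 2 \<and> s7 4 = y_lo \<and> s7 5 = s4 25 \<and> s7 6 = 0 else s7 0 = 1)
        else s7 0 = 1 \<and> s7 1 = y_lo \<and> s7 2 = s4 25 \<and> s7 3 = 0"
    unfolding Let_def T6(5)[symmetric] T4(5)[symmetric] by (simp add: s7_def output_code_def s6)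
  show ?thesis
    using run cost s7 T4(6-8) T6(6-8) unfolding n_def s0_def by blast
qed

section \<open>The ladder Hamiltonian\<close>

text \<open>Parity of a prefix: it tells which of the two sites of rung \<open>i\<close> is
  connected to site 0.\<close>

definition parity :: "bool list \<Rightarrow> nat \<Rightarrow> nat" where
  "parity w i = (\<Sum>k<i. of_bool (w ! k)) mod 2"

definition weight :: "nat \<Rightarrow> nat \<Rightarrow> real" where
  "weight N i = sqrt ((real i + 1) * (real N - real i)) / 2"

definition up :: "bool list \<Rightarrow> nat \<Rightarrow> nat" where
  "up w x = 2 * (x div 2 + 1) + (x mod 2 + of_bool (w ! (x div 2))) mod 2"

text \<open>On rung 0 the truncated subtraction yields a meaningless site of rung 0; every use as a
  neighbour is guarded by \<open>0 < x div 2\<close>.\<close>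

definition down :: "bool list \<Rightarrow> nat \<Rightarrow> nat" where
  "down w x = 2 * (x div 2 - 1) + (x mod 2 + of_bool (w ! (x div 2 - 1))) mod 2"

text \<open>Each edge is given by its upward step, looked at from either end, which makes symmetry
  easy; \<open>hop_eq\<close> recovers the form needed for a single row.\<close>

definition hop :: "nat \<Rightarrow> bool list \<Rightarrow> nat \<Rightarrow> nat \<Rightarrow> real" where
  "hop N w x y = (if x div 2 < N \<and> y = up w x then weight N (x div 2)
    else if y div 2 < N \<and> x = up w y then weight N (y div 2) else 0)"

definition ladder :: "nat \<Rightarrow> bool list \<Rightarrow> complex mat" where
  "ladder N w = mat (2 * (N + 1)) (2 * (N + 1)) (\<lambda>(x, y). complex_of_real (hop N w x y))"

lemma ladder_dim: "dim_row (ladder N w) = 2 * (N + 1)" "dim_col (ladder N w) = 2 * (N + 1)"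
  by (simp_all add: ladder_def)

declare ladder_dim [simp]

lemma ladder_index:
  "x < 2 * (N + 1) \<Longrightarrow> y < 2 * (N + 1) \<Longrightarrow> ladder N w $$ (x, y) = complex_of_real (hop N w x y)"
  by (simp add: ladder_def)

lemma up_div [simp]: "up w x div 2 = x div 2 + 1"
  by (simp add: up_def)

lemma down_div [simp]: "down w x div 2 = x div 2 - 1"
  by (simp add: down_def)

lemma up_mod: "up w x mod 2 = (x mod 2 + of_bool (w ! (x div 2))) mod 2"
  by (simp add: up_def)

lemma down_mod: "down w x mod 2 = (x mod 2 + of_bool (w ! (x div 2 - 1))) mod 2"
  by (simp add: down_def)

lemma eq_div_mod_2: "x = y \<longleftrightarrow> x div 2 = y div 2 \<and> x mod 2 = y mod (2::nat)"
  by (metis div_mult_mod_eq)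

text \<open>XOR with a fixed bit is its own inverse, and \<open>up\<close> and \<open>down\<close>
  along an edge consult the same bit.\<close>

lemma eq_up_iff: "y = up w x \<longleftrightarrow> 0 < y div 2 \<and> x = down w y"
proof (cases "y div 2 = x div 2 + 1")
  case True
  have "a = (b + c) mod 2 \<longleftrightarrow> b = (a + c) mod 2" if "a < 2" "b < 2" "c < 2" for a b c :: nat
    using that by (auto simp: less_2_cases_iff)
  from this[of "y mod 2" "x mod 2"] show ?thesis unfolding eq_div_mod_2[of y] eq_div_mod_2[of x] up_mod down_mod using True by simp
next
  case False
  then show ?thesis unfolding eq_div_mod_2[of y] eq_div_mod_2[of x] by auto
qed

lemma less_twice_iff: "x < 2 * (N + 1) \<longleftrightarrow> x div 2 \<le> (N::nat)"
  by presburger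

lemma up_less: "x div 2 < N \<Longrightarrow> up w x < 2 * (N + 1)"
  unfolding less_twice_iff by simp

lemma down_less: "x < 2 * (N + 1) \<Longrightarrow> down w x < 2 * (N + 1)"
  unfolding less_twice_iff by simp

lemma up_neq_down: "up w x \<noteq> down w x"
  using up_div[of w x] down_div[of w x] by (metis add_diff_cancel_right' diff_add_inverse2 diff_le_self le_add1 le_antisym less_add_one less_irrefl not_less)

lemma hop_eq:
  assumes "x < 2 * (N + 1)"
  shows "hop N w x y = (if x div 2 < N \<and> y = up w x then weight N (x div 2)
    else if 0 < x div 2 \<and> y = down w x then weight N (x div 2 - 1) else 0)"
proof -
  have "y div 2 < N \<and> x = up w y \<longleftrightarrow> 0 < x div 2 \<and> y = down w x"
    unfolding eq_up_iff[of x] using assms by auto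
  then show ?thesis unfolding hop_def by auto
qed

lemma hop_sym: "hop N w x y = hop N w y x"
proof -
  have "\<not> (y = up w x \<and> x = up w y)"
  proof
    assume "y = up w x \<and> x = up w y"
    then have "y div 2 = x div 2 + 1" "x div 2 = y div 2 + 1" by (metis up_div)+
    then show False by linarith
  qed
  then show ?thesis by (auto simp: hop_def)
qed

lemma weight_pos: "i < N \<Longrightarrow> 0 < weight N i"
  by (simp add: weight_def)

lemma hop_nonneg: "0 \<le> hop N w x y"
  using weight_pos by (auto simp: hop_def less_imp_le)

text \<open>Over real algebras in general, because it serves the real vector that gives the norm as
  well as the complex modes.\<close>

lemma sum_hop:
  fixes f :: "nat \<Rightarrow> 'a::real_algebra_1"
  assumes x: "x < 2 * (N + 1)"
  shows "(\<Sum>y<2 * (N + 1). of_real (hop N w x y) * f y) =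
    (if x div 2 < N then of_real (weight N (x div 2)) * f (up w x) else 0) +
    (if 0 < x div 2 then of_real (weight N (x div 2 - 1)) * f (down w x) else 0)"
proof -
  have "(\<Sum>y<2 * (N + 1). of_real (hop N w x y) * f y) =
    (\<Sum>y<2 * (N + 1). (if y = up w x then if x div 2 < N then of_real (weight N (x div 2)) * f y else 0 else 0)
      + (if y = down w x then if 0 < x div 2 then of_real (weight N (x div 2 - 1)) * f y else 0 else 0))"
    using up_neq_down[of w x] unfolding hop_eq[OF x] by (intro sum.cong) auto
  also have "\<dots> = (if x div 2 < N then of_real (weight N (x div 2)) * f (up w x) else 0) +
    (if 0 < x div 2 then of_real (weight N (x div 2 - 1)) * f (down w x) else 0)"
    unfolding sum.distrib using up_less[of x N w] down_less[OF x, of w]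
    by (subst (1 2) sum.delta) auto
  finally show ?thesis .
qed

lemma ladder_hamiltonian: "hamiltonian (2 * (N + 1)) (ladder N w)"
proof -
  have "mat_adjoint (ladder N w) = ladder N w"
    by (rule eq_matI) (simp_all add: ladder_index hop_sym del: mult_Suc_right)
  then show ?thesis by (auto simp: hamiltonian_def hermitian_mat_def square_mat.simps)
qed

lemma ladder_row_support:
  assumes x: "x < 2 * (N + 1)"
  shows "{y. y < 2 * (N + 1) \<and> ladder N w $$ (x, y) \<noteq> 0} =
    (if x div 2 < N then {up w x} else {}) \<union> (if 0 < x div 2 then {down w x} else {})"
proof -
  have "x div 2 - 1 < N" if "0 < x div 2" using x that unfolding less_twice_iff by linarith
  then have w: "0 < x div 2 \<Longrightarrow> weight N (x div 2 - 1) \<noteq> 0"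
    "x div 2 < N \<Longrightarrow> weight N (x div 2) \<noteq> 0"
    using weight_pos less_numeral_extra(3) by metis+
  have "{y. y < 2 * (N + 1) \<and> ladder N w $$ (x, y) \<noteq> 0} = {y. y < 2 * (N + 1) \<and> hop N w x y \<noteq> 0}"
    using x by (auto simp: ladder_index simp del: mult_Suc_right)
  also have "\<dots> = (if x div 2 < N then {up w x} else {}) \<union> (if 0 < x div 2 then {down w x} else {})"
    unfolding hop_eq[OF x] using w up_less[of x N w] down_less[OF x, of w] up_neq_down[of w x] by auto
  finally show ?thesis .
qed

lemma ladder_sparse: "sparse_mat 2 (ladder N w)"
proof -
  have row: "card {y. y < 2 * (N + 1) \<and> ladder N w $$ (x, y) \<noteq> 0} \<le> 2" if "x < 2 * (N + 1)" for x
  proof -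
    have "card {y. y < 2 * (N + 1) \<and> ladder N w $$ (x, y) \<noteq> 0} \<le> card {up w x, down w x}"
      unfolding ladder_row_support[OF that] by (intro card_mono) auto
    also have "\<dots> \<le> 2" by (simp add: card_insert_if)
    finally show ?thesis .
  qed
  have "{y. y < 2 * (N + 1) \<and> ladder N w $$ (y, x) \<noteq> 0} = {y. y < 2 * (N + 1) \<and> ladder N w $$ (x, y) \<noteq> 0}"
    if "x < 2 * (N + 1)" for x
    using that by (auto simp: ladder_index hop_sym simp del: mult_Suc_right)
  then show ?thesis unfolding sparse_mat_def ladder_dim using row by simp
qed

section \<open>Correctness of the computed rows\<close>

text \<open>Two roundings do not accumulate: for integers,
  \<open>v\<^sup>2 \<le> X div 4 < (v + 1)\<^sup>2\<close> is the same as
  \<open>4 * v\<^sup>2 \<le> X < 4 * (v + 1)\<^sup>2\<close>, so the error stays within one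
  unit.\<close>

lemma half_sqrt_approx:
  fixes A v :: int
  assumes "0 \<le> A" "0 \<le> v" "v\<^sup>2 \<le> A * 2 ^ p * 2 ^ p div 4" "A * 2 ^ p * 2 ^ p div 4 < (v + 1)\<^sup>2"
  shows "\<bar>sqrt (real_of_int A) / 2 - real_of_int v / 2 ^ p\<bar> \<le> 1 / 2 ^ p"
proof -
  define X where "X = A * 2 ^ p * 2 ^ p"
  have "4 * v\<^sup>2 \<le> X" "X < 4 * (v + 1)\<^sup>2" using assms(3,4) unfolding X_def[symmetric] by linarith+
  then have "real_of_int (4 * v\<^sup>2) \<le> real_of_int X" "real_of_int X \<le> real_of_int (4 * (v + 1)\<^sup>2)"
    by linarith+
  moreover have X: "real_of_int X = (sqrt (real_of_int A) * 2 ^ p)\<^sup>2"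
    using assms(1) by (simp add: X_def power2_eq_square)
  moreover have "real_of_int (4 * v\<^sup>2) = (2 * real_of_int v)\<^sup>2"
    "real_of_int (4 * (v + 1)\<^sup>2) = (2 * (real_of_int v + 1))\<^sup>2"
    by (simp_all add: power2_eq_square algebra_simps)
  ultimately have "(2 * real_of_int v)\<^sup>2 \<le> (sqrt (real_of_int A) * 2 ^ p)\<^sup>2"
    "(sqrt (real_of_int A) * 2 ^ p)\<^sup>2 \<le> (2 * (real_of_int v + 1))\<^sup>2"
    by metis+
  then have "2 * real_of_int v \<le> sqrt (real_of_int A) * 2 ^ p"
    "sqrt (real_of_int A) * 2 ^ p \<le> 2 * (real_of_int v + 1)"
    using assms(1,2) by (auto intro: power2_le_imp_le)
  then have "real_of_int v / 2 ^ p \<le> sqrt (real_of_int A) / 2"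
    "sqrt (real_of_int A) / 2 \<le> (real_of_int v + 1) / 2 ^ p"
    by (simp_all add: field_simps)
  then show ?thesis unfolding add_divide_distrib by linarith
qed

lemma square_diff_bit:
  "a < 2 \<Longrightarrow> b < 2 \<Longrightarrow> (int a - int b)\<^sup>2 = int ((a + b) mod 2)"
  by (auto simp: less_2_cases_iff)

lemma row_output_single:
  assumes "{y. y < dim_col H \<and> H $$ (x, y) \<noteq> 0} = {a}" "s 0 = 1" "s 1 = int a"
    and "cmod (H $$ (x, a) - Complex (real_of_int (s 2) / 2 ^ p) (real_of_int (s 3) / 2 ^ p)) \<le> 1 / 2 ^ p"
  shows "row_output H x p s"
proof -
  have "{..<nat (s 0)} = {0}" using assms by auto
  then show ?thesis
    unfolding row_output_def assms(1) using assms(2-4) by (auto simp: bij_betw_def numeral_2_eq_2)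
qed

lemma row_output_pair:
  assumes "{y. y < dim_col H \<and> H $$ (x, y) \<noteq> 0} = {a, b}" "a \<noteq> b" "s 0 = 2" "s 1 = int a" "s 4 = int b"
    and "cmod (H $$ (x, a) - Complex (real_of_int (s 2) / 2 ^ p) (real_of_int (s 3) / 2 ^ p)) \<le> 1 / 2 ^ p"
    and "cmod (H $$ (x, b) - Complex (real_of_int (s 5) / 2 ^ p) (real_of_int (s 6) / 2 ^ p)) \<le> 1 / 2 ^ p"
  shows "row_output H x p s"
proof -
  have two: "k < nat (s 0) \<longleftrightarrow> k = 0 \<or> k = 1" for k using assms(3) by auto
  have set: "{..<nat (s 0)} = {0, 1}" using assms(3) by auto
  have bij: "bij_betw (\<lambda>k. s (3 * k + 1)) {0, 1} (int ` {a, b})"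
    using assms(2,4,5) by (auto simp: bij_betw_def inj_on_def)
  have val: "cmod (H $$ (x, nat (s (3 * k + 1)))
        - Complex (real_of_int (s (3 * k + 2)) / 2 ^ p) (real_of_int (s (3 * k + 3)) / 2 ^ p)) \<le> 1 / 2 ^ p"
    if "k = 0 \<or> k = 1" for k
    using that
  proof
    assume "k = 1"
    then have k: "3 * k + 1 = 4" "3 * k + 2 = 5" "3 * k + 3 = 6" by simp_all
    show ?thesis unfolding k assms(5) using assms(7) by simp
  next
    assume "k = 0"
    then have k: "3 * k + 1 = 1" "3 * k + 2 = 2" "3 * k + 3 = 3" by simp_all
    show ?thesis unfolding k assms(4) using assms(6) by simp
  qed
  show ?thesis
    unfolding row_output_def assms(1) set
  proof (intro conjI allI impI)
    show "0 \<le> s 0" using assms(3) by simp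
  qed (use bij val two in blast)+
qed

lemma ladder_row_computes:
  assumes N: "0 < N" and w: "length w = N"
  shows "row_computes row_code 300 w (ladder N w)"
  unfolding row_computes_def ladder_dim
proof (intro allI impI)
  fix x p assume x: "x < 2 * (N + 1)"
  let ?i = "x div 2" and ?j = "x mod 2"
  obtain T s u l where run: "run w row_code (row_input (2 * (N + 1)) x p) T s"
    and T: "T \<le> (floorlog 2 (2 * (N + 1)) + p + 1) ^ 300"
    and u: "0 \<le> u" "u\<^sup>2 \<le> (int ?i + 1) * (int N - int ?i) * 2 ^ p * 2 ^ p div 4"
      "(int ?i + 1) * (int N - int ?i) * 2 ^ p * 2 ^ p div 4 < (u + 1)\<^sup>2"
    and l: "0 \<le> l" "l\<^sup>2 \<le> int ?i * (int N - int ?i + 1) * 2 ^ p * 2 ^ p div 4"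
      "int ?i * (int N - int ?i + 1) * 2 ^ p * 2 ^ p div 4 < (l + 1)\<^sup>2"
    and s: "let y_up = 2 * (int ?i + 1) + (int ?j - word_bit w (int ?i))\<^sup>2;
        y_lo = 2 * (int ?i - 1) + (int ?j - word_bit w (int ?i - 1))\<^sup>2
     in if int ?i < int N then s 1 = y_up \<and> s 2 = u \<and> s 3 = 0 \<and>
          (if 0 < int ?i then s 0 = 2 \<and> s 4 = y_lo \<and> s 5 = l \<and> s 6 = 0 else s 0 = 1)
        else s 0 = 1 \<and> s 1 = y_lo \<and> s 2 = l \<and> s 3 = 0"
    using run_row_code[OF x, of w p] by blast
  have iN: "?i \<le> N" using x unfolding less_twice_iff .
  have bit: "word_bit w (int k) = int (of_bool (w ! k))" if "k < N" for k
    using that w by (simp add: word_bit_def)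
  have up: "2 * (int ?i + 1) + (int ?j - word_bit w (int ?i))\<^sup>2 = int (up w x)" if "?i < N"
    unfolding bit[OF that] by (subst square_diff_bit) (auto simp: up_def)
  have down: "2 * (int ?i - 1) + (int ?j - word_bit w (int ?i - 1))\<^sup>2 = int (down w x)" if "0 < ?i"
  proof -
    have i1: "int ?i - 1 = int (?i - 1)" "?i - 1 < N" using that iN by auto
    show ?thesis unfolding i1(1) bit[OF i1(2)] by (subst square_diff_bit) (auto simp: down_def)
  qed
  have u': "cmod (complex_of_real (weight N ?i) - Complex (real_of_int u / 2 ^ p) 0) \<le> 1 / 2 ^ p"
  proof -
    have "\<bar>weight N ?i - real_of_int u / 2 ^ p\<bar> \<le> 1 / 2 ^ p"
      using half_sqrt_approx[OF _ u] iN by (simp add: weight_def)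
    then show ?thesis by (simp flip: complex_of_real_def of_real_diff del: of_real_divide)
  qed
  have l': "cmod (complex_of_real (weight N (?i - 1)) - Complex (real_of_int l / 2 ^ p) 0) \<le> 1 / 2 ^ p"
    if "0 < ?i"
  proof -
    have "\<bar>weight N (?i - 1) - real_of_int l / 2 ^ p\<bar> \<le> 1 / 2 ^ p"
    proof -
      have "(real (?i - 1) + 1) * (real N - real (?i - 1)) = real_of_int (int ?i * (int N - int ?i + 1))"
        using that by (simp add: of_nat_diff algebra_simps)
      moreover have "0 \<le> int ?i * (int N - int ?i + 1)" using iN by simp
      ultimately show ?thesis using half_sqrt_approx[OF _ l] unfolding weight_def by metis
    qed
    then show ?thesis by (simp flip: complex_of_real_def of_real_diff del: of_real_divide)
  qed
  have hu: "ladder N w $$ (x, up w x) = complex_of_real (weight N ?i)" if "?i < N"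
    using that x up_less[OF that, of w] by (subst ladder_index) (auto simp: hop_eq)
  have hd: "ladder N w $$ (x, down w x) = complex_of_real (weight N (?i - 1))" if "0 < ?i"
    using that x down_less[OF x, of w] up_neq_down[of w x] by (subst ladder_index) (auto simp: hop_eq)
  have "row_output (ladder N w) x p s"
  proof (cases "?i < N")
    case False
    then have "0 < ?i" using N by linarith
    note s' = s[unfolded Let_def down[OF this]]
    have "s 0 = 1" "s 1 = int (down w x)" "s 2 = l" "s 3 = 0" using s' False by auto
    then show ?thesis
      using False \<open>0 < ?i\<close> hd l' ladder_row_support[OF x, of w]
      by (intro row_output_single[of _ _ "down w x"]) simp_all
  next
    case True
    show ?thesis
    proof (cases "0 < ?i")
      case False
      have "s 0 = 1" "s 1 = int (up w x)" "s 2 = u" "s 3 = 0"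
        using s[unfolded Let_def up[OF True]] True False by auto
      then show ?thesis
        using False True hu u' ladder_row_support[OF x, of w]
        by (intro row_output_single[of _ _ "up w x"]) simp_all
    next
      case pos: True
      have s': "s 0 = 2" "s 1 = int (up w x)" "s 2 = u" "s 3 = 0"
        "s 4 = int (down w x)" "s 5 = l" "s 6 = 0"
        using s[unfolded Let_def up[OF True] down[OF pos]] True pos by auto
      have "{y. y < dim_col (ladder N w) \<and> ladder N w $$ (x, y) \<noteq> 0} = {up w x, down w x}"
        unfolding ladder_dim ladder_row_support[OF x] using True pos by auto
      then show ?thesis
        using s' hu[OF True] u' hd[OF pos] l'[OF pos] up_neq_down[of w x]
        by (intro row_output_pair[of _ _ "up w x" "down w x"]) simp_all
    qed
  qed
  then show "\<exists>T s. run w row_code (row_input (2 * (N + 1)) x p) T s \<and>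
      T \<le> (floorlog 2 (2 * (N + 1)) + p + 1) ^ 300 \<and> row_output (ladder N w) x p s"
    using run T by blast
qed

section \<open>Operator norm of the ladder\<close>

lemma euclidean_norm_sum:
  assumes "v \<in> carrier_vec n"
  shows "euclidean_norm v = sqrt (\<Sum>i<n. (cmod (v $ i))\<^sup>2)"
proof -
  have "v \<bullet>c v = complex_of_real (\<Sum>i<n. (cmod (v $ i))\<^sup>2)"
    using assms by (auto simp: scalar_prod_def complex_norm_square[symmetric] complex_mult_cnj
        cmod_def atLeast0LessThan intro!: sum.cong)
  then show ?thesis by (simp add: euclidean_norm_def)
qed

text \<open>The Schur test, with equality because the test vector is an eigenvector.\<close>

lemma operator_norm_perron:
  fixes h :: "nat \<Rightarrow> nat \<Rightarrow> real"
  assumes A: "A = mat n n (\<lambda>(x, y). complex_of_real (h x y))" and n: "0 < n"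
    and h: "\<And>x y. 0 \<le> h x y" "\<And>x y. h x y = h y x"
    and g: "\<And>x. x < n \<Longrightarrow> 0 < g x" and eig: "\<And>x. x < n \<Longrightarrow> (\<Sum>y<n. h x y * g y) = k * g x"
  shows "operator_norm A = k"
proof -
  have k0: "0 \<le> k"
  proof -
    have "0 \<le> k * g 0" unfolding eig[OF n, symmetric] using h g by (intro sum_nonneg mult_nonneg_nonneg) (auto intro: less_imp_le)
    then show ?thesis using g[OF n] by (simp add: zero_le_mult_iff)
  qed
  have Av: "(A *\<^sub>v v) $ x = (\<Sum>y<n. complex_of_real (h x y) * v $ y)"
    if "v \<in> carrier_vec n" "x < n" for v x
    using that by (auto simp: A scalar_prod_def atLeast0LessThan intro!: sum.cong)
  have Ac: "A *\<^sub>v v \<in> carrier_vec n" for v by (rule carrier_vecI) (simp add: A)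
  have le: "euclidean_norm (A *\<^sub>v v) \<le> k * euclidean_norm v" if v: "v \<in> carrier_vec n" for v
  proof -
    have pt: "(cmod ((A *\<^sub>v v) $ x))\<^sup>2 \<le> k * (\<Sum>y<n. (h x y * g x) * ((cmod (v $ y))\<^sup>2 / g y))" if x: "x < n" for x
    proof -
      have "cmod ((A *\<^sub>v v) $ x) \<le> (\<Sum>y<n. h x y * cmod (v $ y))"
        unfolding Av[OF v x] by (rule order_trans[OF norm_sum]) (simp add: norm_mult h)
      then have "(cmod ((A *\<^sub>v v) $ x))\<^sup>2 \<le> (\<Sum>y<n. h x y * cmod (v $ y))\<^sup>2"
        by (intro power_mono) auto
      \<comment> \<open>Weighted Cauchy-Schwarz: the split puts \<open>h x y * g y\<close> into one
        factor, where the eigenvalue equation evaluates the sum.\<close>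
      also have "(\<Sum>y<n. h x y * cmod (v $ y)) = (\<Sum>y<n. sqrt (h x y * g y) * (sqrt (h x y / g y) * cmod (v $ y)))"
      proof (intro sum.cong refl)
        fix y assume "y \<in> {..<n}"
        then have gy: "0 < g y" using g by simp
        have "sqrt (h x y * g y) * sqrt (h x y / g y) = sqrt ((h x y)\<^sup>2)"
          unfolding real_sqrt_mult[symmetric] using gy by (simp add: power2_eq_square)
        then show "h x y * cmod (v $ y) = sqrt (h x y * g y) * (sqrt (h x y / g y) * cmod (v $ y))"
          using h(1)[of x y] by (simp add: mult.assoc[symmetric])
      qed
      also have "\<dots>\<^sup>2 \<le> (\<Sum>y<n. (sqrt (h x y * g y))\<^sup>2) * (\<Sum>y<n. (sqrt (h x y / g y) * cmod (v $ y))\<^sup>2)"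
      proof -
        let ?a = "\<lambda>y. sqrt (h x y * g y)" and ?b = "\<lambda>y. sqrt (h x y / g y) * cmod (v $ y)"
        have "\<bar>\<Sum>y<n. ?a y * ?b y\<bar> \<le> (\<Sum>y<n. \<bar>?a y\<bar> * \<bar>?b y\<bar>)"
          by (rule order_trans[OF sum_abs]) (simp add: abs_mult)
        also have "\<dots> \<le> L2_set ?a {..<n} * L2_set ?b {..<n}" by (rule L2_set_mult_ineq)
        finally have "\<bar>\<Sum>y<n. ?a y * ?b y\<bar>\<^sup>2 \<le> (L2_set ?a {..<n} * L2_set ?b {..<n})\<^sup>2"
          by (intro power_mono) auto
        then show ?thesis by (simp add: L2_set_def power_mult_distrib sum_nonneg)
      qed
      also have "(\<Sum>y<n. (sqrt (h x y * g y))\<^sup>2) = (\<Sum>y<n. h x y * g y)"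
        using h g by (intro sum.cong refl real_sqrt_pow2 mult_nonneg_nonneg) (auto intro: less_imp_le)
      also have "\<dots> = k * g x" by (rule eig[OF x])
      also have "(\<Sum>y<n. (sqrt (h x y / g y) * cmod (v $ y))\<^sup>2) = (\<Sum>y<n. h x y * ((cmod (v $ y))\<^sup>2 / g y))"
      proof (intro sum.cong refl)
        fix y assume "y \<in> {..<n}"
        then have "(sqrt (h x y / g y))\<^sup>2 = h x y / g y"
          using h(1) g by (intro real_sqrt_pow2 divide_nonneg_nonneg) (auto intro: less_imp_le)
        then show "(sqrt (h x y / g y) * cmod (v $ y))\<^sup>2 = h x y * ((cmod (v $ y))\<^sup>2 / g y)"
          by (simp add: power_mult_distrib)
      qed
      finally show ?thesis by (simp add: sum_distrib_left mult_ac)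
    qed
    have "(\<Sum>x<n. (cmod ((A *\<^sub>v v) $ x))\<^sup>2) \<le> (\<Sum>x<n. k * (\<Sum>y<n. (h x y * g x) * ((cmod (v $ y))\<^sup>2 / g y)))"
      using pt by (intro sum_mono) auto
    also have "\<dots> = k * (\<Sum>y<n. \<Sum>x<n. (h x y * g x) * ((cmod (v $ y))\<^sup>2 / g y))"
      unfolding sum_distrib_left[symmetric] by (subst sum.swap) (rule refl)
    \<comment> \<open>After the exchange of sums, symmetry of \<open>h\<close> makes the inner sum
      the eigenvalue equation at \<open>y\<close>, and \<open>g y\<close> cancels.\<close>
    also have "(\<Sum>y<n. \<Sum>x<n. (h x y * g x) * ((cmod (v $ y))\<^sup>2 / g y)) = (\<Sum>y<n. k * (cmod (v $ y))\<^sup>2)"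
    proof (intro sum.cong refl)
      fix y assume "y \<in> {..<n}"
      then have y: "y < n" by simp
      have "(\<Sum>x<n. (h x y * g x) * ((cmod (v $ y))\<^sup>2 / g y)) = (\<Sum>x<n. h y x * g x) * ((cmod (v $ y))\<^sup>2 / g y)"
        unfolding sum_distrib_right by (intro sum.cong refl) (simp add: h(2)[of _ y])
      then show "(\<Sum>x<n. (h x y * g x) * ((cmod (v $ y))\<^sup>2 / g y)) = k * (cmod (v $ y))\<^sup>2"
        unfolding eig[OF y] using g[OF y] by simp
    qed
    finally have "(\<Sum>x<n. (cmod ((A *\<^sub>v v) $ x))\<^sup>2) \<le> k\<^sup>2 * (\<Sum>y<n. (cmod (v $ y))\<^sup>2)"
      by (simp add: sum_distrib_left power2_eq_square mult_ac)
    then have "sqrt (\<Sum>x<n. (cmod ((A *\<^sub>v v) $ x))\<^sup>2) \<le> sqrt (k\<^sup>2 * (\<Sum>y<n. (cmod (v $ y))\<^sup>2))" by simp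
    then show ?thesis
      unfolding euclidean_norm_sum[OF v] euclidean_norm_sum[OF Ac] using k0 by (simp add: real_sqrt_mult)
  qed
  define G where "G = sqrt (\<Sum>x<n. (g x)\<^sup>2)"
  have "0 < (\<Sum>x<n. (g x)\<^sup>2)" using g n by (intro sum_pos) (auto simp: less_imp_neq[symmetric])
  then have G: "0 < G" "G\<^sup>2 = (\<Sum>x<n. (g x)\<^sup>2)" by (simp_all add: G_def)
  define v where "v = vec n (\<lambda>x. complex_of_real (g x / G))"
  have v: "v \<in> carrier_vec n" by (simp add: v_def)
  have nv: "euclidean_norm v = 1"
  proof -
    have "(\<Sum>i<n. (cmod (v $ i))\<^sup>2) = (\<Sum>i<n. (g i)\<^sup>2) / G\<^sup>2"
      unfolding sum_divide_distrib by (intro sum.cong refl) (simp add: v_def norm_divide power_divide)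
    also have "\<dots> = 1" unfolding G(2)[symmetric] using G(1) by simp
    finally show ?thesis unfolding euclidean_norm_sum[OF v] by simp
  qed
  have "A *\<^sub>v v = complex_of_real k \<cdot>\<^sub>v v"
  proof (rule eq_vecI)
    fix x assume "x < dim_vec (complex_of_real k \<cdot>\<^sub>v v)"
    then have x: "x < n" by (simp add: v_def)
    have "(A *\<^sub>v v) $ x = complex_of_real ((\<Sum>y<n. h x y * g y) / G)"
      unfolding Av[OF v x] of_real_divide of_real_sum sum_divide_distrib by (intro sum.cong) (auto simp: v_def)
    then show "(A *\<^sub>v v) $ x = (complex_of_real k \<cdot>\<^sub>v v) $ x" unfolding eig[OF x] using x by (simp add: v_def)
  qed (simp add: A v_def)
  then have "euclidean_norm (A *\<^sub>v v) = k"
  proof -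
    assume eq: "A *\<^sub>v v = complex_of_real k \<cdot>\<^sub>v v"
    have kv: "complex_of_real k \<cdot>\<^sub>v v \<in> carrier_vec n" using v by simp
    have "(\<Sum>i<n. (cmod ((complex_of_real k \<cdot>\<^sub>v v) $ i))\<^sup>2) = k\<^sup>2 * (\<Sum>i<n. (cmod (v $ i))\<^sup>2)"
      unfolding sum_distrib_left using v by (intro sum.cong refl) (simp add: norm_mult power_mult_distrib)
    then have "euclidean_norm (complex_of_real k \<cdot>\<^sub>v v) = k * euclidean_norm v"
      unfolding euclidean_norm_sum[OF v] euclidean_norm_sum[OF kv] using k0 by (simp add: real_sqrt_mult)
    then show ?thesis unfolding eq nv by simp
  qed
  moreover have dc: "dim_col A = n" by (simp add: A)
  ultimately show ?thesis
    unfolding operator_norm_def dc using v nv le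
    by (intro cSup_eq_maximum) (auto intro!: image_eqI[of _ _ v], metis mult.right_neutral)
qed

text \<open>Rescaling by square roots of binomial coefficients makes the irrational weights
  rational, because \<open>(i + 1) * (N choose Suc i) = (N - i) * (N choose i)\<close>. The two
  equations describe one edge seen from its lower and from its upper end.\<close>

lemma weight_mult_sqrt_binomial:
  assumes "i < N"
  shows "weight N i * sqrt (N choose Suc i) = (real N - real i) / 2 * sqrt (N choose i)"
    and "weight N i * sqrt (N choose i) = (real i + 1) / 2 * sqrt (N choose Suc i)"
proof -
  have b: "(real i + 1) * real (N choose Suc i) = (real N - real i) * real (N choose i)"
    using binomial_absorb_comp[of N i] binomial_absorption[of i N] assms
    by (metis (no_types, opaque_lifting) Suc_times_binomial_add add.commute binomial_absorb_comp le_add_diff_inverse less_imp_le of_nat_Suc of_nat_diff of_nat_mult)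
  have "sqrt ((real i + 1) * (real N - real i)) * sqrt (N choose Suc i)
    = sqrt ((real N - real i) * ((real i + 1) * real (N choose Suc i)))"
    by (simp add: real_sqrt_mult[symmetric] mult_ac)
  also have "\<dots> = sqrt ((real N - real i)\<^sup>2 * real (N choose i))" unfolding b by (simp add: power2_eq_square)
  also have "\<dots> = (real N - real i) * sqrt (N choose i)" using assms by (simp add: real_sqrt_mult)
  finally show "weight N i * sqrt (N choose Suc i) = (real N - real i) / 2 * sqrt (N choose i)"
    by (simp add: weight_def)
  have "sqrt ((real i + 1) * (real N - real i)) * sqrt (N choose i)
    = sqrt ((real i + 1) * ((real N - real i) * real (N choose i)))"
    by (simp add: real_sqrt_mult[symmetric] mult_ac)
  also have "\<dots> = sqrt ((real i + 1)\<^sup>2 * real (N choose Suc i))" unfolding b[symmetric] by (simp add: power2_eq_square)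
  also have "\<dots> = (real i + 1) * sqrt (N choose Suc i)" by (simp add: real_sqrt_mult)
  finally show "weight N i * sqrt (N choose i) = (real i + 1) / 2 * sqrt (N choose Suc i)"
    by (simp add: weight_def)
qed

text \<open>The positive eigenvector takes the value \<open>sqrt (N choose i)\<close> at both sites
  of rung \<open>i\<close>, whatever the word is; the contributions from above and below are
  \<open>(N - i) / 2\<close> and \<open>i / 2\<close>.\<close>

lemma ladder_operator_norm: "operator_norm (ladder N w) = real N / 2"
proof (rule operator_norm_perron[OF ladder_def])
  fix x assume x: "x < 2 * (N + 1)"
  let ?i = "x div 2"
  have iN: "?i \<le> N" using x unfolding less_twice_iff .
  show "0 < sqrt (N choose ?i)" using iN by simp
  have "(\<Sum>y<2 * (N + 1). hop N w x y * sqrt (N choose (y div 2))) =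
    (if ?i < N then weight N ?i * sqrt (N choose Suc ?i) else 0) +
    (if 0 < ?i then weight N (?i - 1) * sqrt (N choose (?i - 1)) else 0)"
    using sum_hop[OF x, of w "\<lambda>y. sqrt (N choose (y div 2))"] by simp
  also have "(if ?i < N then weight N ?i * sqrt (N choose Suc ?i) else 0) = (real N - real ?i) / 2 * sqrt (N choose ?i)"
    using weight_mult_sqrt_binomial(1)[of ?i N] iN by auto
  also have "(if 0 < ?i then weight N (?i - 1) * sqrt (N choose (?i - 1)) else 0) = real ?i / 2 * sqrt (N choose ?i)"
    using weight_mult_sqrt_binomial(2)[of "?i - 1" N] iN by auto
  finally show "(\<Sum>y<2 * (N + 1). hop N w x y * sqrt (N choose (y div 2))) = real N / 2 * sqrt (N choose ?i)"
    by (simp add: field_simps)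
qed (auto simp: hop_nonneg hop_sym)

section \<open>Eigenmodes and the evolution for time pi\<close>

text \<open>\<open>mat_exp\<close> is an entrywise series, so the finite sum over \<open>y\<close>
  has to be moved inside the series; this needs the entries of the powers to be summable.\<close>

lemma mat_exp_eigenvector:
  assumes A: "A \<in> carrier_mat n n" and eig: "\<And>x. x < n \<Longrightarrow> (\<Sum>y<n. A $$ (x, y) * u y) = k * u x"
    and x: "x < n"
  shows "(\<Sum>y<n. mat_exp A $$ (x, y) * u y) = exp k * u x"
proof -
  \<comment> \<open>A crude bound on column sums of moduli, which lets entries of the j-th power be
    bounded by \<open>M ^ j\<close>.\<close>
  define M where "M = (\<Sum>y<n. \<Sum>z<n. cmod (A $$ (y, z)))"
  have Ak: "A ^\<^sub>m j \<in> carrier_mat n n" for j using A by simp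
  have step: "(A ^\<^sub>m Suc j) $$ (y, z) = (\<Sum>l<n. (A ^\<^sub>m j) $$ (y, l) * A $$ (l, z))" if "y < n" "z < n" for j y z
    unfolding pow_mat.simps using A Ak[of j] that by (subst mat_mult_index_sum) auto
  have bound: "cmod ((A ^\<^sub>m j) $$ (y, z)) \<le> M ^ j" if "y < n" "z < n" for j y z
    using that
  proof (induction j arbitrary: z)
    case 0
    then show ?case using A by simp
  next
    case (Suc j)
    have "cmod ((A ^\<^sub>m Suc j) $$ (y, z)) \<le> (\<Sum>l<n. cmod ((A ^\<^sub>m j) $$ (y, l)) * cmod (A $$ (l, z)))"
      unfolding step[OF Suc.prems] by (rule order_trans[OF norm_sum]) (simp add: norm_mult)
    also have "\<dots> \<le> (\<Sum>l<n. M ^ j * cmod (A $$ (l, z)))"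
      using Suc by (intro sum_mono mult_right_mono) auto
    also have "\<dots> \<le> M ^ j * M"
      unfolding sum_distrib_left[symmetric] M_def using Suc.prems
      by (intro mult_left_mono sum_mono zero_le_power sum_nonneg) (auto intro!: member_le_sum)
    finally show ?case unfolding power_Suc2 .
  qed
  have summ: "summable (\<lambda>j. (A ^\<^sub>m j) $$ (x, y) / fact j)" if "y < n" for y
  proof (rule summable_comparison_test)
    show "summable (\<lambda>j. M ^ j / fact j)" using summable_exp[of M] by (simp add: field_simps)
    show "\<exists>N. \<forall>j\<ge>N. norm ((A ^\<^sub>m j) $$ (x, y) / fact j) \<le> M ^ j / fact j"
      using bound[OF x that] by (simp add: norm_divide divide_right_mono)
  qed
  have pow: "(\<Sum>y<n. (A ^\<^sub>m j) $$ (z, y) * u y) = k ^ j * u z" if "z < n" for j z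
    using that
  proof (induction j)
    case 0
    have "(\<Sum>y<n. (A ^\<^sub>m 0) $$ (z, y) * u y) = (\<Sum>y<n. if y = z then u y else 0)"
      using A 0 by (intro sum.cong) auto
    then show ?case using 0 by simp
  next
    case (Suc j)
    have "(\<Sum>y<n. (A ^\<^sub>m Suc j) $$ (z, y) * u y) = (\<Sum>y<n. \<Sum>l<n. (A ^\<^sub>m j) $$ (z, l) * (A $$ (l, y) * u y))"
      using step[OF Suc.prems] by (simp add: sum_distrib_right mult.assoc del: pow_mat.simps)
    also have "\<dots> = (\<Sum>l<n. (A ^\<^sub>m j) $$ (z, l) * (\<Sum>y<n. A $$ (l, y) * u y))"
      unfolding sum_distrib_left by (rule sum.swap)
    also have "\<dots> = (\<Sum>l<n. k * ((A ^\<^sub>m j) $$ (z, l) * u l))"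
      using eig by (intro sum.cong) (auto simp: mult_ac)
    also have "\<dots> = k ^ Suc j * u z"
      unfolding sum_distrib_left[symmetric] Suc.IH[OF Suc.prems] by simp
    finally show ?case .
  qed
  have "(\<Sum>y<n. mat_exp A $$ (x, y) * u y) = (\<Sum>y<n. (\<Sum>j. (A ^\<^sub>m j) $$ (x, y) / fact j * u y))"
    using A x summ by (intro sum.cong refl) (simp add: mat_exp_def suminf_mult2)
  also have "\<dots> = (\<Sum>j. \<Sum>y<n. (A ^\<^sub>m j) $$ (x, y) / fact j * u y)"
    using summ by (intro suminf_sum[symmetric] summable_mult2) auto
  also have "\<dots> = (\<Sum>j. k ^ j /\<^sub>R fact j * u x)"
  proof (intro arg_cong[where f = suminf] ext)
    fix j
    have "(\<Sum>y<n. (A ^\<^sub>m j) $$ (x, y) / fact j * u y) = (\<Sum>y<n. (A ^\<^sub>m j) $$ (x, y) * u y) / fact j"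
      unfolding sum_divide_distrib by (intro sum.cong) simp_all
    then show "(\<Sum>y<n. (A ^\<^sub>m j) $$ (x, y) / fact j * u y) = k ^ j /\<^sub>R fact j * u x"
      unfolding pow[OF x] by (simp add: scaleR_conv_of_real field_simps)
  qed
  also have "\<dots> = exp k * u x"
    using sums_mult2[OF exp_converges[of k], of "u x"] by (rule sums_unique[symmetric])
  finally show ?thesis .
qed

text \<open>
  Identifying site \<open>i\<close> with \<open>sqrt (N choose i) * z ^ i\<close> turns the path into the operator
  \<open>((1 - z\<^sup>2) * p' + N * z * p) / 2\<close>, with eigenvectors \<open>(1 - z) ^ m * (1 + z) ^ (N - m)\<close>.
\<close>

definition krawtchouk_poly :: "nat \<Rightarrow> nat \<Rightarrow> complex poly" where
  "krawtchouk_poly N m = [:1, -1:] ^ m * [:1, 1:] ^ (N - m)"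

text \<open>Since \<open>1 - z\<^sup>2\<close> factors as \<open>(1 - z) * (1 + z)\<close>, the
  product rule reproduces the polynomial times \<open>(N - m) * (1 - z) - m * (1 + z)\<close>, that
  is \<open>N - 2 * m - N * z\<close>.\<close>

lemma krawtchouk_poly_ode:
  assumes "m \<le> N"
  shows "(1 - [:0, 1:] ^ 2) * pderiv (krawtchouk_poly N m) + smult (of_nat N) ([:0, 1:] * krawtchouk_poly N m)
    = smult (of_nat N - 2 * of_nat m) (krawtchouk_poly N m)"
proof -
  let ?a = "[:1, -1:] :: complex poly" and ?b = "[:1, 1:] :: complex poly"
  have fac: "1 - [:0, 1:] ^ 2 = ?a * ?b" by (simp add: power2_eq_square one_pCons)
  have pow: "q * pderiv (q ^ k) = smult (of_nat k) (q ^ k) * pderiv q" for q :: "complex poly" and k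
  proof (cases k)
    case (Suc n)
    show ?thesis
      unfolding Suc pderiv_power_Suc by (simp only: power_Suc mult_smult_left mult_smult_right mult.assoc)
  qed simp
  have pa: "?a * pderiv (?a ^ m) = smult (- of_nat m) (?a ^ m)"
    unfolding pow by (simp add: pderiv_pCons)
  have pb: "?b * pderiv (?b ^ (N - m)) = smult (of_nat (N - m)) (?b ^ (N - m))"
    unfolding pow by (simp add: pderiv_pCons)
  have "?a * ?b * pderiv (?a ^ m * ?b ^ (N - m)) =
    ?b * (?a * pderiv (?a ^ m)) * ?b ^ (N - m) + ?a * (?b * pderiv (?b ^ (N - m))) * ?a ^ m"
    by (simp add: pderiv_mult algebra_simps del: mult_pCons_left mult_pCons_right)
  also have "\<dots> = (smult (- of_nat m) ?b + smult (of_nat (N - m)) ?a) * (?a ^ m * ?b ^ (N - m))"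
    unfolding pa pb by (simp add: algebra_simps del: mult_pCons_left mult_pCons_right smult_pCons)
  also have "smult (- of_nat m) ?b + smult (of_nat (N - m)) ?a
    = [:of_nat N - 2 * of_nat m:] - smult (of_nat N) [:0, 1:]"
    using assms by (simp add: of_nat_diff)
  finally show ?thesis unfolding krawtchouk_poly_def fac
    by (simp add: algebra_simps del: mult_pCons_left mult_pCons_right) (simp add: algebra_simps)
qed

text \<open>Comparison of the coefficients of \<open>z ^ i\<close>. Coefficient \<open>i - 1\<close>
  collects \<open>N\<close> from the multiplication by \<open>z\<close> and \<open>- (i - 1)\<close>
  from the derivative.\<close>

lemma krawtchouk_poly_recurrence:
  assumes "m \<le> N"
  shows "(of_nat i + 1) * coeff (krawtchouk_poly N m) (Suc i) +
    (if 0 < i then (of_nat N - of_nat i + 1) * coeff (krawtchouk_poly N m) (i - 1) else 0)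
    = (of_nat N - 2 * of_nat m) * coeff (krawtchouk_poly N m) i"
proof -
  let ?p = "krawtchouk_poly N m"
  have eq: "(1 - [:0, 1:] ^ 2) * q = q - pCons 0 (pCons 0 q)" for q :: "complex poly"
    by (simp only: power2_eq_square left_diff_distrib mult_1_left mult.assoc) simp
  have "coeff (pderiv ?p - pCons 0 (pCons 0 (pderiv ?p)) + smult (of_nat N) (pCons 0 ?p)) i =
    coeff (smult (of_nat N - 2 * of_nat m) ?p) i"
    using krawtchouk_poly_ode[OF assms] unfolding eq by simp
  then show ?thesis
    by (cases i; cases "i - 1") (auto simp: coeff_pderiv coeff_pCons algebra_simps split: nat.splits)
qed

lemma krawtchouk_poly_degree: "m \<le> N \<Longrightarrow> degree (krawtchouk_poly N m) \<le> N"
  unfolding krawtchouk_poly_def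
  by (rule order_trans[OF degree_mult_le])
    (use degree_power_le[of "[:1, -1:] :: complex poly" m] degree_power_le[of "[:1, 1:] :: complex poly" "N - m"] in auto)

text \<open>Expands both end states, the constant 1 and \<open>z ^ N\<close>, in the modes; the
  coefficients differ only by the sign \<open>(- 1) ^ m\<close>.\<close>

lemma krawtchouk_poly_sum:
  "(\<Sum>m\<le>N. smult (of_nat (N choose m)) (krawtchouk_poly N m)) = [:2 ^ N:]"
  "(\<Sum>m\<le>N. smult (of_nat (N choose m) * (- 1) ^ m) (krawtchouk_poly N m)) = monom (2 ^ N) N"
proof -
  let ?a = "[:1, -1:] :: complex poly" and ?b = "[:1, 1:] :: complex poly"
  have "(?a + ?b) ^ N = (\<Sum>m\<le>N. smult (of_nat (N choose m)) (krawtchouk_poly N m))"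
    unfolding binomial_ring krawtchouk_poly_def by (intro sum.cong refl) (simp add: of_nat_poly mult.assoc)
  moreover have "?a + ?b = [:2:]" by simp
  ultimately show "(\<Sum>m\<le>N. smult (of_nat (N choose m)) (krawtchouk_poly N m)) = [:2 ^ N:]"
    by (simp add: poly_const_pow)
  have "(- ?a + ?b) ^ N = (\<Sum>m\<le>N. smult (of_nat (N choose m) * (- 1) ^ m) (krawtchouk_poly N m))"
    unfolding binomial_ring krawtchouk_poly_def
    by (intro sum.cong refl) (simp add: of_nat_poly mult.assoc power_minus[of ?a] minus_one_power_iff del: minus_pCons)
  moreover have "- ?a + ?b = monom 2 1" by (simp add: monom_Suc monom_0)
  ultimately show "(\<Sum>m\<le>N. smult (of_nat (N choose m) * (- 1) ^ m) (krawtchouk_poly N m)) = monom (2 ^ N) N"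
    by (simp add: monom_power)
qed

text \<open>An eigenvector on the component of site 0, zero on the other component. Dividing by the
  square root passes from coefficients of \<open>z ^ i\<close> to amplitudes of sites.\<close>

definition mode :: "nat \<Rightarrow> bool list \<Rightarrow> nat \<Rightarrow> nat \<Rightarrow> complex" where
  "mode N w m x = (if x mod 2 = parity w (x div 2)
    then coeff (krawtchouk_poly N m) (x div 2) / sqrt (N choose (x div 2)) else 0)"

lemma parity_Suc: "parity w (Suc i) = (parity w i + of_bool (w ! i)) mod 2"
  by (simp add: parity_def mod_simps)

lemma parity_less_2: "parity w i < 2"
  by (simp add: parity_def)

text \<open>Along an edge the position within the rung and the prefix parity are changed by the same
  bit, so edges stay within a component.\<close>

lemma up_parity: "up w x mod 2 = parity w (up w x div 2) \<longleftrightarrow> x mod 2 = parity w (x div 2)"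
proof -
  have "(a + c) mod 2 = (b + c) mod 2 \<longleftrightarrow> a = b" if "a < 2" "b < 2" "c < 2" for a b c :: nat
    using that by (auto simp: less_2_cases_iff)
  from this[of "x mod 2" "parity w (x div 2)" "of_bool (w ! (x div 2))"]
  show ?thesis using parity_less_2 by (simp add: up_mod parity_Suc)
qed

lemma down_parity:
  "0 < x div 2 \<Longrightarrow> down w x mod 2 = parity w (down w x div 2) \<longleftrightarrow> x mod 2 = parity w (x div 2)"
  using up_parity[of w "down w x"] eq_up_iff[of x w "down w x"] by simp

lemma mode_eigenvector:
  assumes x: "x < 2 * (N + 1)" and m: "m \<le> N"
  shows "(\<Sum>y<2 * (N + 1). complex_of_real (hop N w x y) * mode N w m y)
    = (of_nat N / 2 - of_nat m) * mode N w m x"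
proof (cases "x mod 2 = parity w (x div 2)")
  case False
  then show ?thesis
    unfolding sum_hop[OF x] mode_def[of _ _ _ "up w x"] mode_def[of _ _ _ "down w x"] up_parity
    using down_parity[of x w] by (auto simp: mode_def)
next
  case True
  let ?i = "x div 2"
  let ?c = "coeff (krawtchouk_poly N m)"
  let ?b = "\<lambda>i. complex_of_real (sqrt (N choose i))"
  have iN: "?i \<le> N" using x unfolding less_twice_iff .
  have bnz: "?b i \<noteq> 0" if "i \<le> N" for i using that by simp
  have cross: "s / z = a / b \<Longrightarrow> t = c / z \<Longrightarrow> s * t = a * c / b" for s t z a b c :: complex
    by (metis times_divide_eq_left times_divide_eq_right)
  have "(if ?i < N then of_real (weight N ?i) * mode N w m (up w x) else 0) = (of_nat ?i + 1) / 2 * ?c (Suc ?i) / ?b ?i"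
  proof (cases "?i < N")
    case less: True
    have "complex_of_real (weight N ?i) * ?b ?i = (of_nat ?i + 1) / 2 * ?b (Suc ?i)"
      using arg_cong[OF weight_mult_sqrt_binomial(2)[OF less], of complex_of_real] by simp
    then have "complex_of_real (weight N ?i) / ?b (Suc ?i) = (of_nat ?i + 1) / 2 / ?b ?i"
      using bnz[of ?i] bnz[of "Suc ?i"] less by (simp add: divide_simps mult_ac)
    moreover have "mode N w m (up w x) = ?c (Suc ?i) / ?b (Suc ?i)"
      unfolding mode_def up_parity using True by simp
    ultimately have "complex_of_real (weight N ?i) * mode N w m (up w x) =
      (of_nat ?i + 1) / 2 * ?c (Suc ?i) / ?b ?i" by (rule cross)
    then show ?thesis using less by simp
  next
    case False
    \<comment> \<open>On the top rung the missing neighbour matches a coefficient beyond the degree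
      \<open>N\<close>.\<close>
    then have "?c (Suc ?i) = 0" using krawtchouk_poly_degree[OF m] iN by (intro coeff_eq_0) auto
    then show ?thesis using False by simp
  qed
  moreover have "(if 0 < ?i then of_real (weight N (?i - 1)) * mode N w m (down w x) else 0)
    = (if 0 < ?i then (of_nat N - of_nat ?i + 1) / 2 * ?c (?i - 1) / ?b ?i else 0)"
  proof (cases "0 < ?i")
    case pos: True
    then have less: "?i - 1 < N" and Suc: "Suc (?i - 1) = ?i" using iN by auto
    have "complex_of_real (weight N (?i - 1)) * ?b ?i = (of_nat N - of_nat (?i - 1)) / 2 * ?b (?i - 1)"
      using arg_cong[OF weight_mult_sqrt_binomial(1)[OF less], of complex_of_real] Suc by simp
    also have "of_nat (?i - 1) = (of_nat ?i - 1 :: complex)" using pos by (simp add: of_nat_diff)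
    finally have "complex_of_real (weight N (?i - 1)) / ?b (?i - 1) = (of_nat N - of_nat ?i + 1) / 2 / ?b ?i"
      using bnz[of ?i] bnz[of "?i - 1"] iN by (simp add: divide_simps mult_ac)
    moreover have "mode N w m (down w x) = ?c (?i - 1) / ?b (?i - 1)"
      unfolding mode_def down_parity[OF pos] using True by simp
    ultimately have "complex_of_real (weight N (?i - 1)) * mode N w m (down w x) =
      (of_nat N - of_nat ?i + 1) / 2 * ?c (?i - 1) / ?b ?i" by (rule cross)
    then show ?thesis using pos by simp
  qed simp
  moreover have "s / 2 * p / b + (if P then t / 2 * q / b else 0) = (s * p + (if P then t * q else 0)) / 2 / b"
    for s t p q b :: complex and P by (simp add: add_divide_distrib)
  ultimately have "(\<Sum>y<2 * (N + 1). complex_of_real (hop N w x y) * mode N w m y) =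
    ((of_nat ?i + 1) * ?c (Suc ?i) + (if 0 < ?i then (of_nat N - of_nat ?i + 1) * ?c (?i - 1) else 0)) / 2 / ?b ?i"
    unfolding sum_hop[OF x] by (simp only:)
  also have "\<dots> = (of_nat N / 2 - of_nat m) * mode N w m x"
    unfolding krawtchouk_poly_recurrence[OF m] using True by (simp add: mode_def field_simps)
  finally show ?thesis .
qed

text \<open>Reads off the coefficients in \<open>krawtchouk_poly_sum\<close>; the square root is 1
  on the two end rungs, the only ones that matter.\<close>

lemma mode_sum:
  assumes x: "x < 2 * (N + 1)"
  shows "(\<Sum>m\<le>N. of_nat (N choose m) * mode N w m x) = (if x = 0 then 2 ^ N else 0)"
    and "(\<Sum>m\<le>N. of_nat (N choose m) * (- 1) ^ m * mode N w m x) = (if x = 2 * N + parity w N then 2 ^ N else 0)"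
proof -
  let ?i = "x div 2"
  have pull: "(\<Sum>m\<le>N. f m * mode N w m x) = (if x mod 2 = parity w ?i
    then coeff (\<Sum>m\<le>N. smult (f m) (krawtchouk_poly N m)) ?i / sqrt (N choose ?i) else 0)" for f
    by (simp add: mode_def coeff_sum sum_divide_distrib)
  have "x = 0 \<longleftrightarrow> x mod 2 = parity w ?i \<and> ?i = 0"
    unfolding eq_div_mod_2[of x] by (auto simp: parity_def)
  then show "(\<Sum>m\<le>N. of_nat (N choose m) * mode N w m x) = (if x = 0 then 2 ^ N else 0)"
    unfolding pull krawtchouk_poly_sum by (auto simp: coeff_pCons split: nat.splits)
  have "x = 2 * N + parity w N \<longleftrightarrow> x mod 2 = parity w ?i \<and> ?i = N"
    unfolding eq_div_mod_2[of x] using parity_less_2[of w N] by auto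
  then show "(\<Sum>m\<le>N. of_nat (N choose m) * (- 1) ^ m * mode N w m x) = (if x = 2 * N + parity w N then 2 ^ N else 0)"
    unfolding pull krawtchouk_poly_sum by auto
qed

lemma exp_minus_i_pi: "exp (- \<i> * complex_of_real pi * (of_nat N / 2 - of_nat m))
  = exp (- \<i> * complex_of_real pi * (of_nat N / 2)) * (- 1) ^ m"
proof -
  have "exp (- \<i> * complex_of_real pi * (of_nat N / 2 - of_nat m))
    = exp (- \<i> * complex_of_real pi * (of_nat N / 2)) * exp (of_nat m * (\<i> * complex_of_real pi))"
    unfolding exp_add[symmetric] by (simp add: algebra_simps)
  also have "exp (of_nat m * (\<i> * complex_of_real pi)) = (- 1) ^ m"
    unfolding exp_of_nat_mult by (simp add: mult.commute)
  finally show ?thesis .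
qed

lemma ladder_evolution:
  assumes x: "x < 2 * (N + 1)"
  shows "evolution (ladder N w) pi $$ (x, 0) =
    (if x = 2 * N + parity w N then exp (- \<i> * complex_of_real pi * (of_nat N / 2)) else 0)"
proof -
  let ?d = "2 * (N + 1)"
  define A where "A = (- \<i> * complex_of_real pi) \<cdot>\<^sub>m ladder N w"
  define ph where "ph = exp (- \<i> * complex_of_real pi * (of_nat N / 2))"
  have A: "A \<in> carrier_mat ?d ?d" by (rule carrier_matI) (simp_all add: A_def)
  have eig: "(\<Sum>y<?d. mat_exp A $$ (x, y) * mode N w m y) = ph * (- 1) ^ m * mode N w m x" if m: "m \<le> N" for m
  proof -
    have "(\<Sum>y<?d. A $$ (z, y) * mode N w m y) = - \<i> * complex_of_real pi * (of_nat N / 2 - of_nat m) * mode N w m z"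
      if z: "z < ?d" for z
    proof -
      have "(\<Sum>y<?d. A $$ (z, y) * mode N w m y) =
        (\<Sum>y<?d. - \<i> * complex_of_real pi * (complex_of_real (hop N w z y) * mode N w m y))"
        using z by (intro sum.cong refl) (auto simp: A_def ladder_index simp del: mult_Suc_right)
      then show ?thesis unfolding sum_distrib_left[symmetric] mode_eigenvector[OF z m] by (simp add: mult_ac)
    qed
    from mat_exp_eigenvector[OF A this x] show ?thesis unfolding exp_minus_i_pi ph_def .
  qed
  \<comment> \<open>Column 0 of the exponential is its action on the initial site, which
    \<open>mode_sum\<close> writes as a combination of modes. The phases then turn the first sum of
    \<open>mode_sum\<close> into the second.\<close>
  have "2 ^ N * mat_exp A $$ (x, 0) = (\<Sum>y<?d. mat_exp A $$ (x, y) * (if y = 0 then 2 ^ N else 0))"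
    by (subst sum.cong[where h = "\<lambda>y. if y = 0 then 2 ^ N * mat_exp A $$ (x, 0) else 0", OF refl]) auto
  also have "\<dots> = (\<Sum>y<?d. mat_exp A $$ (x, y) * (\<Sum>m\<le>N. of_nat (N choose m) * mode N w m y))"
    by (intro sum.cong refl) (subst mode_sum(1), auto)
  also have "\<dots> = (\<Sum>y<?d. \<Sum>m\<le>N. of_nat (N choose m) * (mat_exp A $$ (x, y) * mode N w m y))"
    by (simp add: sum_distrib_left mult_ac)
  also have "\<dots> = (\<Sum>m\<le>N. of_nat (N choose m) * (\<Sum>y<?d. mat_exp A $$ (x, y) * mode N w m y))"
    unfolding sum_distrib_left by (rule sum.swap)
  also have "\<dots> = (\<Sum>m\<le>N. ph * (of_nat (N choose m) * (- 1) ^ m * mode N w m x))"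
    using eig by (intro sum.cong refl) simp
  also have "\<dots> = ph * (if x = 2 * N + parity w N then 2 ^ N else 0)"
    unfolding sum_distrib_left[symmetric] mode_sum(2)[OF x] ..
  finally have "mat_exp A $$ (x, 0) = (if x = 2 * N + parity w N then ph else 0)" by (simp split: if_splits)
  then show ?thesis unfolding evolution_def A_def ph_def by simp
qed

text \<open>From here on dimensions are normalised to the variable \<open>d\<close>, by
  \<open>ladder_d\<close>.\<close>

declare ladder_dim [simp del]

section \<open>Low-degree functions of the word and the query bound\<close>

text \<open>Multilinear polynomials of degree at most \<open>k\<close> in \<open>N\<close> bits,
  represented as sums of functions of at most \<open>k\<close> bits; scalars need no rule because
  each summand can absorb them.\<close>

inductive low_degree :: "nat \<Rightarrow> nat \<Rightarrow> (bool list \<Rightarrow> complex) \<Rightarrow> bool" for N k where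
  junta: "S \<subseteq> {..<N} \<Longrightarrow> card S \<le> k \<Longrightarrow>
    (\<And>w w'. length w = N \<Longrightarrow> length w' = N \<Longrightarrow> (\<And>b. b \<in> S \<Longrightarrow> w ! b = w' ! b) \<Longrightarrow> f w = f w') \<Longrightarrow>
    low_degree N k f"
| add: "low_degree N k f \<Longrightarrow> low_degree N k g \<Longrightarrow> low_degree N k (\<lambda>w. f w + g w)"

lemma low_degree_const: "low_degree N k (\<lambda>_. c)"
  by (rule junta[of "{}"]) auto

lemma low_degree_cnj: "low_degree N k f \<Longrightarrow> low_degree N k (\<lambda>w. cnj (f w))"
proof (induction rule: low_degree.induct)
  case (junta S f)
  show ?case by (rule low_degree.junta[OF junta(1,2)]) (metis junta(3))
next
  case (add f g)
  then show ?case using low_degree.add[of N k "\<lambda>w. cnj (f w)" "\<lambda>w. cnj (g w)"] by simp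
qed

lemma low_degree_mult:
  assumes f: "low_degree N k f" and g: "low_degree N l g"
  shows "low_degree N (k + l) (\<lambda>w. f w * g w)"
  using f
proof (induction rule: low_degree.induct)
  case (junta S f)
  note f = junta
  from g show ?case
  proof (induction rule: low_degree.induct)
    case (junta T g)
    show ?case
    proof (rule low_degree.junta)
      show "S \<union> T \<subseteq> {..<N}" using f(1) junta(1) by simp
      show "card (S \<union> T) \<le> k + l" using card_Un_le[of S T] f(2) junta(2) by linarith
    next
      fix w w' :: "bool list" assume "length w = N" "length w' = N" "\<And>b. b \<in> S \<union> T \<Longrightarrow> w ! b = w' ! b"
      then have "f w = f w'" "g w = g w'" using f(3) junta(3) by blast+
      then show "f w * g w = f w' * g w'" by simp
    qed
  next
    case (add g h)
    then show ?case using low_degree.add[of N "k + l" "\<lambda>w. f w * g w" "\<lambda>w. f w * h w"]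
      by (simp add: distrib_left)
  qed
next
  case (add f h)
  then show ?case using low_degree.add[of N "k + l" "\<lambda>w. f w * g w" "\<lambda>w. h w * g w"]
    by (simp add: distrib_right)
qed

lemma low_degree_scale:
  "low_degree N k f \<Longrightarrow> low_degree N k (\<lambda>w. c * f w)" "low_degree N k f \<Longrightarrow> low_degree N k (\<lambda>w. f w * c)"
  using low_degree_mult[OF low_degree_const[of N 0 c], of k f]
    low_degree_mult[OF _ low_degree_const[of N 0 c], of k f] by simp_all

lemma low_degree_sum:
  "(\<And>i. i \<in> I \<Longrightarrow> low_degree N k (\<lambda>w. f i w)) \<Longrightarrow> low_degree N k (\<lambda>w. \<Sum>i\<in>I. f i w)"
proof (induction I rule: infinite_finite_induct)
  case (insert i I)
  then show ?case by (simp add: add)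
qed (simp_all add: low_degree_const)

lemma finite_words: "finite {w :: bool list. length w = N}"
  using finite_lists_length_eq[of "UNIV :: bool set" N] by simp

text \<open>The product form isolates the factor of a single bit, so that flipping this bit visibly
  changes the sign.\<close>

lemma sign_parity: "(- 1) ^ parity w N = (\<Prod>k<N. if w ! k then - 1 else 1 :: complex)"
proof -
  have "(- 1 :: complex) ^ parity w N = (- 1) ^ (\<Sum>k<N. of_bool (w ! k))"
    unfolding parity_def by (simp add: minus_one_power_iff)
  also have "\<dots> = (\<Prod>k<N. (- 1) ^ of_bool (w ! k))" by (rule power_sum)
  also have "\<dots> = (\<Prod>k<N. if w ! k then - 1 else 1 :: complex)" by (intro prod.cong) auto
  finally show ?thesis .
qed

text \<open>Parity is orthogonal to every junta that misses a variable: flip that variable.\<close>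

lemma low_degree_parity_orthogonal:
  assumes "low_degree N k f" "k < N"
  shows "(\<Sum>w | length w = N. (- 1) ^ parity w N * f w) = 0"
  using assms(1)
proof (induction rule: low_degree.induct)
  case (junta S f)
  have "card S < card {..<N}" using junta(2) assms(2) by simp
  then have "\<not> {..<N} \<subseteq> S" using card_mono[of S "{..<N}"] finite_subset[OF junta(1)] by auto
  then obtain b where b: "b < N" "b \<notin> S" by auto
  define flip where "flip w = w[b := \<not> w ! b]" for w :: "bool list"
  let ?L = "{w :: bool list. length w = N}"
  have flip: "length (flip w) = N" "flip (flip w) = w" if "length w = N" for w
    using that b by (simp_all add: flip_def)
  have sign: "(- 1 :: complex) ^ parity (flip w) N = - ((- 1) ^ parity w N)" if "length w = N" for w
  proof -
    have "(\<Prod>k\<in>{..<N} - {b}. if flip w ! k then - 1 else 1 :: complex) = (\<Prod>k\<in>{..<N} - {b}. if w ! k then - 1 else 1)"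
      by (intro prod.cong refl) (auto simp: flip_def)
    then show ?thesis unfolding sign_parity using b that
      by (simp add: prod.remove[of "{..<N}" b] flip_def)
  qed
  have inv: "f (flip w) = f w" if "length w = N" for w
    using that flip b by (intro junta(3)) (auto simp: flip_def nth_list_update)
  have "(\<Sum>w\<in>?L. (- 1) ^ parity w N * f w) = (\<Sum>w\<in>?L. (- 1) ^ parity (flip w) N * f (flip w))"
    by (rule sum.reindex_bij_witness[of _ flip flip]) (use flip in auto)
  also have "\<dots> = (\<Sum>w\<in>?L. - ((- 1) ^ parity w N * f w))"
    using sign inv by (intro sum.cong) auto
  finally have "(\<Sum>w\<in>?L. (- 1) ^ parity w N * f w) = - (\<Sum>w\<in>?L. (- 1) ^ parity w N * f w)"
    by (simp add: sum_negf)
  then show ?case by simp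
next
  case (add f g)
  then show ?case by (simp add: distrib_left sum.distrib)
qed

section \<open>Tensor products, column data and basis states\<close>

lemma kronecker_dim [simp]:
  "dim_row (A \<otimes>\<^sub>K B) = dim_row A * dim_row B" "dim_col (A \<otimes>\<^sub>K B) = dim_col A * dim_col B"
  by (simp_all add: kronecker_def)

lemma kronecker_index:
  "i < dim_row A * dim_row B \<Longrightarrow> j < dim_col A * dim_col B \<Longrightarrow>
    (A \<otimes>\<^sub>K B) $$ (i, j) = A $$ (i div dim_row B, j div dim_col B) * B $$ (i mod dim_row B, j mod dim_col B)"
  by (simp add: kronecker_def)

lemma kronecker_adjoint: "mat_adjoint (A \<otimes>\<^sub>K B) = mat_adjoint A \<otimes>\<^sub>K mat_adjoint B"
proof (rule eq_matI)
  fix i j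
  assume "i < dim_row (mat_adjoint A \<otimes>\<^sub>K mat_adjoint B)" "j < dim_col (mat_adjoint A \<otimes>\<^sub>K mat_adjoint B)"
  then have ij: "i < dim_col A * dim_col B" "j < dim_row A * dim_row B" by auto
  then have "0 < dim_col B" "0 < dim_row B" by (auto intro!: gr0I)
  then show "mat_adjoint (A \<otimes>\<^sub>K B) $$ (i, j) = (mat_adjoint A \<otimes>\<^sub>K mat_adjoint B) $$ (i, j)"
    using ij by (simp add: kronecker_index less_mult_imp_div_less)
qed simp_all

text \<open>A site of rung \<open>i\<close> meets only the edges governed by bits
  \<open>i - 1\<close> and \<open>i\<close>. The intersection drops bit \<open>N\<close> on the top
  rung, and on rung 0 the truncated \<open>i - 1\<close> coincides with \<open>i\<close>.\<close>

lemma column_data_ladder_cong: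
  assumes x: "x < 2 * (N + 1)"
    and w: "\<And>b. b \<in> {x div 2 - 1, x div 2} \<inter> {..<N} \<Longrightarrow> w ! b = w' ! b"
  shows "column_data (ladder N w) x = column_data (ladder N w') x"
proof -
  have xN: "x div 2 \<le> N" using x unfolding less_twice_iff .
  have "x div 2 < N \<Longrightarrow> up w x = up w' x" "0 < x div 2 \<Longrightarrow> down w x = down w' x"
    using w[of "x div 2"] w[of "x div 2 - 1"] xN by (auto simp: up_def down_def)
  then have "hop N w x y = hop N w' x y" for y unfolding hop_eq[OF x] by auto
  then have eq: "ladder N w $$ (y, x) = ladder N w' $$ (y, x)" if "y < 2 * (N + 1)" for y
    using that x by (simp add: ladder_index hop_sym[of N _ y] del: mult_Suc_right)
  then show ?thesis unfolding column_data_def ladder_dim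
    by (intro map_cong filter_cong refl) (auto simp: eq simp del: upt_Suc mult_Suc_right)
qed

lemma query_oracle_dim [simp]:
  "dim_row (query_oracle r enc H) = dim_row H * 2 ^ r" "dim_col (query_oracle r enc H) = dim_row H * 2 ^ r"
  by (simp_all add: query_oracle_def)

lemma zero_state_density: "0 < n \<Longrightarrow> density_operator n (zero_state n)"
proof -
  assume n: "0 < n"
  have "zero_state n = 1\<^sub>m n * mat_diag n (\<lambda>i. complex_of_real (if i = 0 then 1 else 0)) * mat_adjoint (1\<^sub>m n)"
    by (simp, rule eq_matI) (auto simp: zero_state_def mat_diag_def)
  then have "psd_mat (zero_state n)" using psd_unitary_conj[of "1\<^sub>m n" n "\<lambda>i. if i = 0 then 1 else 0"] by simp
  then show ?thesis using n by (simp add: density_operator_def zero_state_def mat_trace_def)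
qed

lemma zero_state_conj_diag:
  assumes E: "E \<in> carrier_mat n n" and i: "i < n"
  shows "(E * zero_state n * mat_adjoint E) $$ (i, i) = complex_of_real ((cmod (E $$ (i, 0)))\<^sup>2)"
proof -
  have "(E * zero_state n * mat_adjoint E) $$ (i, i) =
    (\<Sum>m<n. (\<Sum>l<n. E $$ (i, l) * zero_state n $$ (l, m)) * cnj (E $$ (i, m)))"
    using E i by (subst mat_mult_index_sum) (auto simp: zero_state_def scalar_prod_def atLeast0LessThan intro!: sum.cong)
  also have "\<dots> = (\<Sum>m<n. if m = 0 then E $$ (i, 0) * cnj (E $$ (i, 0)) else 0)"
  proof (intro sum.cong refl)
    fix m assume "m \<in> {..<n}"
    then have "(\<Sum>l<n. E $$ (i, l) * zero_state n $$ (l, m)) = (\<Sum>l<n. if l = 0 then (if m = 0 then E $$ (i, 0) else 0) else 0)"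
      by (intro sum.cong) (auto simp: zero_state_def)
    then show "(\<Sum>l<n. E $$ (i, l) * zero_state n $$ (l, m)) * cnj (E $$ (i, m)) =
      (if m = 0 then E $$ (i, 0) * cnj (E $$ (i, 0)) else 0)" using i by simp
  qed
  also have "\<dots> = complex_of_real ((cmod (E $$ (i, 0)))\<^sup>2)" using i by (simp add: complex_norm_square[symmetric])
  finally show ?thesis .
qed

lemma sandwich_hermitian:
  fixes C R :: "complex mat"
  assumes "C \<in> carrier_mat n n" "R \<in> carrier_mat n n" "mat_adjoint R = R"
  shows "mat_adjoint (C * R * mat_adjoint C) = C * R * mat_adjoint C"
  using assms by (auto simp: mat_adjoint_mult mat_mult_assoc)

lemma block_index_less:
  fixes i k :: nat
  assumes "i < n" "k < m"
  shows "i * m + k < n * m"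
proof -
  have "i * m + k < (i + 1) * m" using assms(2) by simp
  also have "\<dots> \<le> n * m" using assms(1) by (intro mult_le_mono1) simp
  finally show ?thesis .
qed

section \<open>Degree of circuit outputs and the count of queries\<close>

context
  fixes N r W d a :: nat and enc :: "(nat \<times> complex) list \<Rightarrow> nat"
  assumes d_def: "d = 2 * (N + 1)" and a_def: "a = ancilla_dim d r W"
begin

lemma ladder_d: "dim_row (ladder N w) = d" "dim_col (ladder N w) = d"
  by (simp_all add: d_def ladder_dim)

lemma query_oracle_low_degree:
  assumes ij: "i < d * 2 ^ r" "j < d * 2 ^ r"
  shows "low_degree N 2 (\<lambda>w. query_oracle r enc (ladder N w) $$ (i, j))"
proof -
  let ?x = "j div 2 ^ r"
  have x: "?x < d" using ij(2) by (rule less_mult_imp_div_less)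
  show ?thesis
  proof (rule junta)
    show "{?x div 2 - 1, ?x div 2} \<inter> {..<N} \<subseteq> {..<N}" by simp
    have "card ({?x div 2 - 1, ?x div 2} \<inter> {..<N}) \<le> card {?x div 2 - 1, ?x div 2}" by (intro card_mono) auto
    also have "\<dots> \<le> 2" by (simp add: card_insert_if)
    finally show "card ({?x div 2 - 1, ?x div 2} \<inter> {..<N}) \<le> 2" .
  next
    fix w w' :: "bool list"
    assume "\<And>b. b \<in> {?x div 2 - 1, ?x div 2} \<inter> {..<N} \<Longrightarrow> w ! b = w' ! b"
    then have "column_data (ladder N w) ?x = column_data (ladder N w') ?x"
      by (rule column_data_ladder_cong[OF x[unfolded d_def]])
    then show "query_oracle r enc (ladder N w) $$ (i, j) = query_oracle r enc (ladder N w') $$ (i, j)"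
      using ij by (simp add: query_oracle_def ladder_d)
  qed
qed

text \<open>Each entry is an entry of \<open>Q w\<close> times constants. \<open>Q\<close> is
  general so as to cover the oracle and its adjoint alike.\<close>

lemma tensor_low_degree:
  assumes dim: "\<And>w. dim_row (Q w) = d * 2 ^ r" "\<And>w. dim_col (Q w) = d * 2 ^ r"
    and Q: "\<And>i j. i < d * 2 ^ r \<Longrightarrow> j < d * 2 ^ r \<Longrightarrow> low_degree N k (\<lambda>w. Q w $$ (i, j))"
    and ij: "i < d * a" "j < d * a"
  shows "low_degree N k (\<lambda>w. (1\<^sub>m d \<otimes>\<^sub>K Q w \<otimes>\<^sub>K 1\<^sub>m W) $$ (i, j))"
proof -
  have a: "0 < a" using ij by (auto intro!: gr0I)
  have "d * 2 ^ r * W = a" by (simp add: a_def ancilla_dim_def)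
  then have less: "i mod a < d * 2 ^ r * W" "j mod a < d * 2 ^ r * W" using a by simp_all
  have eq: "(1\<^sub>m d \<otimes>\<^sub>K Q w \<otimes>\<^sub>K 1\<^sub>m W) $$ (i, j) =
    (1\<^sub>m d) $$ (i div a, j div a) * (Q w $$ (i mod a div W, j mod a div W) * (1\<^sub>m W) $$ (i mod a mod W, j mod a mod W))" for w
    using ij less by (simp add: kronecker_index dim a_def ancilla_dim_def)
  show ?thesis unfolding eq
    by (intro low_degree_scale Q less_mult_imp_div_less less)
qed

lemma gate_mat_low_degree:
  assumes ij: "i < d * a" "j < d * a"
  shows "low_degree N (if g = Query \<or> g = InverseQuery then 2 else 0) (\<lambda>w. gate_mat r enc W (ladder N w) g $$ (i, j))"
proof (cases g)
  case (Gate U)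
  then show ?thesis by (simp add: low_degree_const)
next
  case Query
  then show ?thesis
    using tensor_low_degree[of "\<lambda>w. query_oracle r enc (ladder N w)" 2, OF _ _ query_oracle_low_degree ij]
    by (simp add: ladder_d)
next
  case InverseQuery
  have "low_degree N 2 (\<lambda>w. mat_adjoint (query_oracle r enc (ladder N w)) $$ (i, j))"
    if "i < d * 2 ^ r" "j < d * 2 ^ r" for i j
    using low_degree_cnj[OF query_oracle_low_degree[OF that(2,1)]] that by (simp add: ladder_d)
  from tensor_low_degree[of "\<lambda>w. mat_adjoint (query_oracle r enc (ladder N w))" 2, OF _ _ this ij]
  show ?thesis using InverseQuery by (simp add: ladder_d)
qed

lemma gate_mat_carrier:
  assumes "valid_circuit d r W gs" "g \<in> set gs"
  shows "gate_mat r enc W (ladder N w) g \<in> carrier_mat (d * a) (d * a)"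
  using assms by (cases g)
    (auto simp: valid_circuit_def unitary_mat_def square_mat.simps a_def ancilla_dim_def ladder_d intro!: carrier_matI)

lemma circuit_mat_carrier:
  "valid_circuit d r W gs \<Longrightarrow> circuit_mat r enc W (ladder N w) gs \<in> carrier_mat (d * a) (d * a)"
proof (induction gs)
  case (Cons g gs)
  have "valid_circuit d r W gs" using Cons.prems by (auto simp: valid_circuit_def)
  from Cons.IH[OF this] gate_mat_carrier[OF Cons.prems, of g w] show ?case by simp
qed (simp add: ladder_d a_def)

lemma circuit_mat_low_degree:
  assumes "valid_circuit d r W gs" "i < d * a" "j < d * a"
  shows "low_degree N (2 * query_count gs) (\<lambda>w. circuit_mat r enc W (ladder N w) gs $$ (i, j))"
  using assms
proof (induction gs arbitrary: i j)
  case Nil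
  then show ?case unfolding circuit_mat.simps ladder_d by (simp add: low_degree_const)
next
  case (Cons g gs)
  have v: "valid_circuit d r W gs" using Cons.prems by (auto simp: valid_circuit_def)
  let ?q = "if g = Query \<or> g = InverseQuery then 2 else 0"
  have eq: "circuit_mat r enc W (ladder N w) (g # gs) $$ (i, j) =
    (\<Sum>k<d * a. circuit_mat r enc W (ladder N w) gs $$ (i, k) * gate_mat r enc W (ladder N w) g $$ (k, j))" for w
    using circuit_mat_carrier[OF v, of w] gate_mat_carrier[OF Cons.prems(1), of g w] Cons.prems(2,3)
    unfolding circuit_mat.simps by (subst mat_mult_index_sum) auto
  have count: "2 * query_count (g # gs) = 2 * query_count gs + ?q" by (simp add: query_count_def)
  show ?case unfolding eq count using Cons.prems(2,3)
    by (intro low_degree_sum low_degree_mult Cons.IH[OF v] gate_mat_low_degree) simp_all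
qed

text \<open>A diagonal entry combines products of one circuit entry and one conjugated circuit
  entry, which doubles the degree \<open>2 * query_count gs\<close> of amplitudes.\<close>

lemma circuit_output_low_degree:
  assumes v: "valid_circuit d r W gs" and \<rho>: "\<rho> \<in> carrier_mat d d" and i: "i < d"
  shows "low_degree N (4 * query_count gs) (\<lambda>w. circuit_output r enc W (ladder N w) gs \<rho> $$ (i, i))"
proof -
  let ?C = "\<lambda>w. circuit_mat r enc W (ladder N w) gs" and ?R = "\<rho> \<otimes>\<^sub>K zero_state a"
  have C: "?C w \<in> carrier_mat (d * a) (d * a)" for w by (rule circuit_mat_carrier[OF v])
  have R: "?R \<in> carrier_mat (d * a) (d * a)" using \<rho> by (auto simp: zero_state_def)
  have idx: "i * a + k < d * a" if "k < a" for k
    using block_index_less[OF i that] .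
  have eq: "circuit_output r enc W (ladder N w) gs \<rho> $$ (i, i) =
    (\<Sum>k<a. \<Sum>m<d * a. (\<Sum>l<d * a. ?C w $$ (i * a + k, l) * ?R $$ (l, m)) * cnj (?C w $$ (i * a + k, m)))" for w
  proof -
    have "circuit_output r enc W (ladder N w) gs \<rho> $$ (i, i) =
      (\<Sum>k<a. (?C w * ?R * mat_adjoint (?C w)) $$ (i * a + k, i * a + k))"
      using i by (simp add: circuit_output_def partial_trace_def Let_def ladder_d a_def)
    also have "\<dots> = (\<Sum>k<a. \<Sum>m<d * a. (\<Sum>l<d * a. ?C w $$ (i * a + k, l) * ?R $$ (l, m)) * cnj (?C w $$ (i * a + k, m)))"
    proof (intro sum.cong refl)
      fix k assume "k \<in> {..<a}"
      then have q: "i * a + k < d * a" using idx by simp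
      have "(?C w * ?R * mat_adjoint (?C w)) $$ (i * a + k, i * a + k) =
        (\<Sum>m<d * a. (?C w * ?R) $$ (i * a + k, m) * mat_adjoint (?C w) $$ (m, i * a + k))"
        using C[of w] R q by (subst mat_mult_index_sum) auto
      also have "\<dots> = (\<Sum>m<d * a. (\<Sum>l<d * a. ?C w $$ (i * a + k, l) * ?R $$ (l, m)) * cnj (?C w $$ (i * a + k, m)))"
        using C[of w] R q by (intro sum.cong refl) (subst mat_mult_index_sum; auto)
      finally show "(?C w * ?R * mat_adjoint (?C w)) $$ (i * a + k, i * a + k) =
        (\<Sum>m<d * a. (\<Sum>l<d * a. ?C w $$ (i * a + k, l) * ?R $$ (l, m)) * cnj (?C w $$ (i * a + k, m)))" .
    qed
    finally show ?thesis .
  qed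
  have "low_degree N (2 * query_count gs + 2 * query_count gs) (\<lambda>w. circuit_output r enc W (ladder N w) gs \<rho> $$ (i, i))"
    unfolding eq
    by (intro low_degree_sum low_degree_mult low_degree_scale low_degree_cnj circuit_mat_low_degree[OF v] idx) simp_all
  then show ?thesis by simp
qed

lemma circuit_output_hermitian:
  assumes v: "valid_circuit d r W gs" and \<rho>: "\<rho> \<in> carrier_mat d d" "mat_adjoint \<rho> = \<rho>"
  shows "circuit_output r enc W (ladder N w) gs \<rho> \<in> carrier_mat d d"
    and "mat_adjoint (circuit_output r enc W (ladder N w) gs \<rho>) = circuit_output r enc W (ladder N w) gs \<rho>"
proof -
  let ?C = "circuit_mat r enc W (ladder N w) gs" and ?R = "\<rho> \<otimes>\<^sub>K zero_state a"
  define M where "M = ?C * ?R * mat_adjoint ?C"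
  have C: "?C \<in> carrier_mat (d * a) (d * a)" by (rule circuit_mat_carrier[OF v])
  have R: "?R \<in> carrier_mat (d * a) (d * a)" using \<rho> by (auto simp: zero_state_def)
  have "mat_adjoint (zero_state a) = zero_state a" by (rule eq_matI) (auto simp: zero_state_def)
  then have "mat_adjoint ?R = ?R" unfolding kronecker_adjoint \<rho>(2) by simp
  then have herm: "mat_adjoint M = M"
    unfolding M_def using C R by (intro sandwich_hermitian)
  have M: "M \<in> carrier_mat (d * a) (d * a)" unfolding M_def using C R by auto
  have out: "circuit_output r enc W (ladder N w) gs \<rho> = partial_trace d a M"
    by (simp add: circuit_output_def M_def Let_def ladder_d a_def)
  then show "circuit_output r enc W (ladder N w) gs \<rho> \<in> carrier_mat d d" by (simp add: partial_trace_def)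
  have idx: "i * a + k < d * a" if "k < a" "i < d" for i k
    using block_index_less[OF that(2,1)] .
  have "cnj (M $$ (p, q)) = M $$ (q, p)" if "p < d * a" "q < d * a" for p q
    using arg_cong[OF herm, of "\<lambda>A. A $$ (q, p)"] M that by simp
  then have "mat_adjoint (partial_trace d a M) = partial_trace d a M"
    using idx by (intro eq_matI) (auto simp: partial_trace_def intro!: sum.cong)
  then show "mat_adjoint (circuit_output r enc W (ladder N w) gs \<rho>) = circuit_output r enc W (ladder N w) gs \<rho>"
    unfolding out .
qed

lemma evolution_carrier: "evolution (ladder N w) t \<in> carrier_mat d d"
  by (simp add: evolution_def mat_exp_def ladder_d)

text \<open>The state \<open>zero_state d\<close> is the site (0, 0), which the exact evolution
  carries to \<open>2 * N + parity w N\<close> with probability 1. Trace distance 1/4 lets the two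
  top diagonal entries deviate by 1/2 in total, so the signed difference stays at least 1 -
  1/2.\<close>

lemma parity_bias:
  assumes v: "valid_circuit d r W gs" and sim: "simulates r enc W gs (ladder N w) pi (1 / 4)"
  defines "out \<equiv> circuit_output r enc W (ladder N w) gs (zero_state d)"
  shows "1 / 2 \<le> Re ((- 1) ^ parity w N * (out $$ (2 * N, 2 * N) - out $$ (2 * N + 1, 2 * N + 1)))"
proof -
  let ?E = "evolution (ladder N w) pi"
  define B where "B = ?E * zero_state d * mat_adjoint ?E"
  have Z: "zero_state d \<in> carrier_mat d d" "mat_adjoint (zero_state d) = zero_state d"
    by (simp add: zero_state_def, rule eq_matI) (auto simp: zero_state_def)
  have E: "?E \<in> carrier_mat d d" by (rule evolution_carrier)
  have B: "B \<in> carrier_mat d d" "mat_adjoint B = B"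
    unfolding B_def using E Z sandwich_hermitian[OF E Z] by auto
  have out: "out \<in> carrier_mat d d" "mat_adjoint out = out"
    unfolding out_def using circuit_output_hermitian[OF v Z] by auto
  have Bii: "B $$ (i, i) = (if i = 2 * N + parity w N then 1 else 0)" if "i < d" for i
    unfolding B_def zero_state_conj_diag[OF E that] ladder_evolution[OF that[unfolded d_def]] by simp
  have "trace_distance out B \<le> 1 / 4"
    using sim zero_state_density[of d] by (simp add: simulates_def out_def B_def ladder_d) (simp add: d_def)
  moreover have "(\<Sum>i\<in>{2 * N, 2 * N + 1}. cmod (out $$ (i, i) - B $$ (i, i))) \<le> 2 * trace_distance out B"
    by (rule sum_diag_le_trace_distance[OF out(1) B(1) out(2) B(2)]) (auto simp: d_def)
  ultimately have close: "cmod (out $$ (2 * N, 2 * N) - B $$ (2 * N, 2 * N)) +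
    cmod (out $$ (2 * N + 1, 2 * N + 1) - B $$ (2 * N + 1, 2 * N + 1)) \<le> 1 / 2" by simp
  have re: "Re B0 - Re B1 - (cmod (o0 - B0) + cmod (o1 - B1)) \<le> Re (o0 - o1)"
    "Re B1 - Re B0 - (cmod (o0 - B0) + cmod (o1 - B1)) \<le> Re (o1 - o0)" for o0 o1 B0 B1
    using abs_Re_le_cmod[of "o0 - B0"] abs_Re_le_cmod[of "o1 - B1"] by auto
  consider "parity w N = 0" | "parity w N = 1" using parity_less_2[of w N] by linarith
  then show ?thesis
  proof cases
    case 1
    then have "B $$ (2 * N, 2 * N) = 1" "B $$ (2 * N + 1, 2 * N + 1) = 0" using Bii[of "2 * N"] Bii[of "2 * N + 1"] by (simp_all add: d_def)
    then show ?thesis using re(1)[of "B $$ (2 * N, 2 * N)" "B $$ (2 * N + 1, 2 * N + 1)"] close 1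
      by (simp del: One_nat_def Suc_eq_plus1 add_Suc_right) (smt (verit))
  next
    case 2
    then have "B $$ (2 * N, 2 * N) = 0" "B $$ (2 * N + 1, 2 * N + 1) = 1" using Bii[of "2 * N"] Bii[of "2 * N + 1"] by (simp_all add: d_def)
    then show ?thesis using re(2)[of "B $$ (2 * N + 1, 2 * N + 1)" "B $$ (2 * N, 2 * N)"] close 2
      by (simp del: One_nat_def Suc_eq_plus1 add_Suc_right) (smt (verit))
  qed
qed

text \<open>With too few queries the difference of the two output probabilities is orthogonal to
  parity, yet each word contributes at least 1/2 to that correlation.\<close>

lemma query_lower_bound:
  assumes v: "valid_circuit d r W gs"
    and sim: "\<And>w. length w = N \<Longrightarrow> simulates r enc W gs (ladder N w) pi (1 / 4)"
  shows "N \<le> 4 * query_count gs"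
proof (rule ccontr)
  assume "\<not> N \<le> 4 * query_count gs"
  then have less: "4 * query_count gs < N" by simp
  define out where "out w i = circuit_output r enc W (ladder N w) gs (zero_state d) $$ (i, i)" for w i
  have Z: "zero_state d \<in> carrier_mat d d" by (simp add: zero_state_def)
  have "low_degree N (4 * query_count gs) (\<lambda>w. out w (2 * N) + (- 1) * out w (2 * N + 1))"
    unfolding out_def by (intro add low_degree_scale circuit_output_low_degree[OF v Z]) (simp_all add: d_def)
  from low_degree_parity_orthogonal[OF this less]
  have zero: "(\<Sum>w | length w = N. (- 1) ^ parity w N * (out w (2 * N) - out w (2 * N + 1))) = 0" by simp
  have "0 < (\<Sum>w | length w = N. Re ((- 1) ^ parity w N * (out w (2 * N) - out w (2 * N + 1))))"
  proof (rule sum_pos)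
    show "finite {w :: bool list. length w = N}" by (rule finite_words)
    show "{w :: bool list. length w = N} \<noteq> {}" using length_replicate[of N True] by blast
    fix w :: "bool list" assume "w \<in> {w. length w = N}"
    then show "0 < Re ((- 1) ^ parity w N * (out w (2 * N) - out w (2 * N + 1)))"
      using parity_bias[OF v sim[of w]] unfolding out_def by simp
  qed
  then show False unfolding Re_sum[symmetric] zero by simp
qed

end

theorem theorem3:
  shows "\<exists>P c. \<forall>N::nat. N > 0 \<longrightarrow>
    (\<exists>(d::nat) (H :: bool list \<Rightarrow> complex mat).
       0 < d \<and>
       (\<forall>w. length w = N \<longrightarrow>
          hamiltonian d (H w) \<and> sparse_mat 2 (H w) \<and> 0 < operator_norm (H w) \<and>
          row_computes P c w (H w)) \<and>
       (\<forall>r enc W gs (\<tau>::real).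
          \<tau> = pi * real N / 2 \<longrightarrow>
          valid_encoding d (H ` {w. length w = N}) r enc \<longrightarrow>
          valid_circuit d r W gs \<longrightarrow>
          (\<forall>w. length w = N \<longrightarrow>
             simulates r enc W gs (H w) (\<tau> / operator_norm (H w)) (1 / 4)) \<longrightarrow>
          real (query_count gs) \<ge> \<tau> / (2 * pi)))"
proof (rule exI[of _ row_code], rule exI[of _ 300], intro allI impI)
  fix N :: nat assume N: "N > 0"
  show "\<exists>(d::nat) (H :: bool list \<Rightarrow> complex mat).
       0 < d \<and>
       (\<forall>w. length w = N \<longrightarrow>
          hamiltonian d (H w) \<and> sparse_mat 2 (H w) \<and> 0 < operator_norm (H w) \<and>
          row_computes row_code 300 w (H w)) \<and>
       (\<forall>r enc W gs (\<tau>::real).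
          \<tau> = pi * real N / 2 \<longrightarrow>
          valid_encoding d (H ` {w. length w = N}) r enc \<longrightarrow>
          valid_circuit d r W gs \<longrightarrow>
          (\<forall>w. length w = N \<longrightarrow>
             simulates r enc W gs (H w) (\<tau> / operator_norm (H w)) (1 / 4)) \<longrightarrow>
          real (query_count gs) \<ge> \<tau> / (2 * pi))"
  proof (rule exI[of _ "2 * (N + 1)"], rule exI[of _ "ladder N"], intro conjI allI impI)
    fix r enc W gs and \<tau> :: real
    assume \<tau>: "\<tau> = pi * real N / 2" and v: "valid_circuit (2 * (N + 1)) r W gs"
      and sim: "\<forall>w. length w = N \<longrightarrow>
        simulates r enc W gs (ladder N w) (\<tau> / operator_norm (ladder N w)) (1 / 4)"
    \<comment> \<open>The norm is \<open>N / 2\<close> for every word, so all members are evolved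
      for the same time, the one at which state transfer is perfect.\<close>
    have "\<tau> / operator_norm (ladder N w) = pi" for w
      using N by (simp add: \<tau> ladder_operator_norm)
    then have "N \<le> 4 * query_count gs"
      using sim by (intro query_lower_bound[OF refl refl v, of enc]) simp
    then show "real (query_count gs) \<ge> \<tau> / (2 * pi)" by (simp add: \<tau>)
  qed (use N ladder_hamiltonian ladder_sparse ladder_row_computes in \<open>simp_all add: ladder_operator_norm\<close>)
qed

end
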